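(* Let $p$ be a probability density on $\mathbb{R}^d$ which is absolutely continuous with respect to the standard $d$-dimensional Gaussian measure $\gamma_d$ and has finite second moment. Suppose that the velocity field $V$ associated with $p$ satisfies $$V\in L^1\Big([0,1],W^{1,\infty}(\mathbb{R}^d,\mathbb{R}^d)\Big).$$ Then the Föllmer transport map $X_1$ and the Langevin transport map $L_{\infty,\infty}$ coincide: $X_1=L_{\infty,\infty}$ almost everywhere.
   Context: Let $r(x)=p(x)/\gamma_d(x)$ (ratio of densities), and for $t\in[0,1]$ let $Q_tr(x)=\int r(tx+\sqrt{1-t^2}\,z)\,d\gamma_d(z)$. Velocity field: $V(t,x)=\frac1t\nabla\log Q_tr(x)$ for $t>0$ (gradient in $x$), extended at $t=0$ by its limit $V(0,x)=\int y\,dp(y)$. Föllmer transport map: $X_t(x)$ is the solution of $\partial_tX_t(x)=V(t,X_t(x))$, $X_0(x)=x$; the Föllmer transport map is $X_1$. Langevin transport map: for $s\in[0,\infty)$ and $t\in[0,s]$, $L_{s,t}(x)$ is the solution of $\partial_tL_{s,t}(x)=\nabla(\log Q_{e^{-(s-t)}}r)(L_{s,t}(x))$, $L_{s,0}(x)=x$; the Langevin transport map is $L_{\infty,\infty}=\lim_{s\to\infty}L_{s,s}$. *)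

theory Defs
  imports "HOL-Probability.Probability"
begin

definition gauss_density :: "'a::euclidean_space \<Rightarrow> real" where
  "gauss_density x = (2 * pi) powr (- real DIM('a) / 2) * exp (- (norm x)\<^sup>2 / 2)"

definition gauss_measure :: "'a::euclidean_space measure" where
  "gauss_measure = density lborel (\<lambda>x. ennreal (gauss_density x))"

definition rel_density :: "('a::euclidean_space \<Rightarrow> real) \<Rightarrow> 'a \<Rightarrow> real" where
  "rel_density p x = p x / gauss_density x"

definition Q_op :: "real \<Rightarrow> ('a::euclidean_space \<Rightarrow> real) \<Rightarrow> 'a \<Rightarrow> real" where
  "Q_op t r x = (\<integral>z. r (t *\<^sub>R x + sqrt (1 - t\<^sup>2) *\<^sub>R z) \<partial>gauss_measure)"

(* An unspecified vector where f is not differentiable. Below this can only happen for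
   Q_op 1 r = r, i.e. at a single endpoint time, whose value affects neither L1_W1inf nor
   ivp_solution. *)
definition gradient :: "('a::euclidean_space \<Rightarrow> real) \<Rightarrow> 'a \<Rightarrow> 'a" where
  "gradient f x = (THE D. GDERIV f x :> D)"

definition score :: "('a::euclidean_space \<Rightarrow> real) \<Rightarrow> real \<Rightarrow> 'a \<Rightarrow> 'a" where
  "score p t x = gradient (\<lambda>y. ln (Q_op t (rel_density p) y)) x"

definition velocity :: "('a::euclidean_space \<Rightarrow> real) \<Rightarrow> real \<Rightarrow> 'a \<Rightarrow> 'a" where
  "velocity p t x =
     (if t = 0 then (\<integral>y. y \<partial>density lborel (\<lambda>y. ennreal (p y)))
      else (1 / t) *\<^sub>R score p t x)"


text \<open>Sobolev space \<open>W\<^sup>1\<^sup>,\<^sup>\<infinity>\<close>, with weak derivatives tested against \<open>C\<^sub>c\<^sup>\<infinity>\<close> functions.\<close>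

primrec C_k :: "nat \<Rightarrow> ('a::euclidean_space \<Rightarrow> real) \<Rightarrow> bool" where
  "C_k 0 f \<longleftrightarrow> continuous_on UNIV f"
| "C_k (Suc k) f \<longleftrightarrow> (\<forall>x. f differentiable (at x)) \<and>
     (\<forall>b\<in>Basis. C_k k (\<lambda>x. frechet_derivative f (at x) b))"

definition test_function :: "('a::euclidean_space \<Rightarrow> real) \<Rightarrow> bool" where
  "test_function \<phi> \<longleftrightarrow> (\<forall>k. C_k k \<phi>) \<and> compact (closure {x. \<phi> x \<noteq> 0})"

definition locally_integrable :: "('a::euclidean_space \<Rightarrow> 'b::euclidean_space) \<Rightarrow> bool" where
  "locally_integrable u \<longleftrightarrow> (\<forall>K. compact K \<longrightarrow> set_integrable lborel K u)"

definition weak_partial ::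
  "('a::euclidean_space \<Rightarrow> 'b::euclidean_space) \<Rightarrow> 'a \<Rightarrow> ('a \<Rightarrow> 'b) \<Rightarrow> bool" where
  "weak_partial u b g \<longleftrightarrow> locally_integrable u \<and> locally_integrable g \<and>
     (\<forall>\<phi>. test_function \<phi> \<longrightarrow>
        (\<integral>x. frechet_derivative \<phi> (at x) b *\<^sub>R u x \<partial>lborel) = - (\<integral>x. \<phi> x *\<^sub>R g x \<partial>lborel))"

definition Linf_norm :: "('a::euclidean_space \<Rightarrow> 'b::euclidean_space) \<Rightarrow> ennreal" where
  "Linf_norm u = esssup lborel (\<lambda>x. ennreal (norm (u x)))"

(* Weak partial derivatives are unique up to null sets, so the infimum ranges over at most one
   value; it is the infimum of the empty set, i.e. infinity, if u is not weakly differentiable. *)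
definition W1inf_norm :: "('a::euclidean_space \<Rightarrow> 'b::euclidean_space) \<Rightarrow> ennreal" where
  "W1inf_norm u =
     (INF g\<in>{g. \<forall>b\<in>Basis. weak_partial u b (g b)}. Linf_norm u + (\<Sum>b\<in>Basis. Linf_norm (g b)))"

(* Finiteness of the integral forces V t to lie in W^{1,infinity} for almost every t. Since that
   space is not separable, measurability is required of V jointly and of the norm, not in the
   Bochner sense. *)
definition L1_W1inf :: "(real \<Rightarrow> 'a::euclidean_space \<Rightarrow> 'a) \<Rightarrow> bool" where
  "L1_W1inf V \<longleftrightarrow>
     case_prod V \<in> borel_measurable (lebesgue_on ({0..1} \<times> UNIV)) \<and>
     (\<lambda>t. W1inf_norm (V t)) \<in> borel_measurable (lebesgue_on {0..1}) \<and>
     (\<integral>\<^sup>+t. W1inf_norm (V t) \<partial>lebesgue_on {0..1}) < \<infinity>"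


text \<open>Initial value problems on \<open>[0, T]\<close>. The fields used below are regular for \<open>t < T\<close> but may
  be undefined at \<open>t = T\<close>, where only continuity of the solution is required.\<close>

definition ivp_solution ::
  "(real \<Rightarrow> 'a::euclidean_space \<Rightarrow> 'a) \<Rightarrow> real \<Rightarrow> 'a \<Rightarrow> (real \<Rightarrow> 'a) \<Rightarrow> bool" where
  "ivp_solution F T x X \<longleftrightarrow> X 0 = x \<and> continuous_on {0..T} X \<and>
     (\<forall>t\<in>{0..<T}. (X has_vector_derivative F t (X t)) (at t within {0..T}))"

definition ivp_unique_solution ::
  "(real \<Rightarrow> 'a::euclidean_space \<Rightarrow> 'a) \<Rightarrow> real \<Rightarrow> 'a \<Rightarrow> bool" where
  "ivp_unique_solution F T x \<longleftrightarrow> (\<exists>X. ivp_solution F T x X) \<and>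
     (\<forall>X Y. ivp_solution F T x X \<longrightarrow> ivp_solution F T x Y \<longrightarrow> (\<forall>t\<in>{0..T}. X t = Y t))"

definition ivp_flow ::
  "(real \<Rightarrow> 'a::euclidean_space \<Rightarrow> 'a) \<Rightarrow> real \<Rightarrow> 'a \<Rightarrow> real \<Rightarrow> 'a" where
  "ivp_flow F T x t = (THE y. \<exists>X. ivp_solution F T x X \<and> X t = y)"


definition follmer_flow :: "('a::euclidean_space \<Rightarrow> real) \<Rightarrow> real \<Rightarrow> 'a \<Rightarrow> 'a" where
  "follmer_flow p t x = ivp_flow (velocity p) 1 x t"

definition follmer_map :: "('a::euclidean_space \<Rightarrow> real) \<Rightarrow> 'a \<Rightarrow> 'a" where
  "follmer_map p = follmer_flow p 1"

definition langevin_field :: "('a::euclidean_space \<Rightarrow> real) \<Rightarrow> real \<Rightarrow> real \<Rightarrow> 'a \<Rightarrow> 'a" where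
  "langevin_field p s t = score p (exp (- (s - t)))"

definition langevin_flow :: "('a::euclidean_space \<Rightarrow> real) \<Rightarrow> real \<Rightarrow> real \<Rightarrow> 'a \<Rightarrow> 'a" where
  "langevin_flow p s t x = ivp_flow (langevin_field p s) s x t"

definition langevin_map :: "('a::euclidean_space \<Rightarrow> real) \<Rightarrow> 'a \<Rightarrow> 'a" where
  "langevin_map p x = Lim at_top (\<lambda>s. langevin_flow p s s x)"


text \<open>The descriptions \<open>THE\<close> and \<open>Lim\<close> in the two maps are meaningful at \<open>x\<close>.\<close>

definition follmer_map_defined :: "('a::euclidean_space \<Rightarrow> real) \<Rightarrow> 'a \<Rightarrow> bool" where
  "follmer_map_defined p x \<longleftrightarrow> ivp_unique_solution (velocity p) 1 x"

definition langevin_map_defined :: "('a::euclidean_space \<Rightarrow> real) \<Rightarrow> 'a \<Rightarrow> bool" where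
  "langevin_map_defined p x \<longleftrightarrow>
     (\<forall>s\<ge>0. ivp_unique_solution (langevin_field p s) s x) \<and>
     (\<exists>l. ((\<lambda>s. langevin_flow p s s x) \<longlongrightarrow> l) at_top)"

end

theory Submission
  imports Defs
begin

text \<open>Completing the square in \<open>Q_op\<close> gives, with \<open>P\<close> the law of density \<open>p\<close>,
  \<open>V t x = (m(t, x) - t x) / (1 - t^2)\<close>, where \<open>m(t, x)\<close> is the mean of \<open>P\<close> reweighted by
  \<open>exp (- |t y - x|^2 / (2 (1 - t^2)))\<close>. Hence \<open>V\<close> is continuous on \<open>[0, 1) \<times> \<real>^d\<close>, including at
  \<open>t = 0\<close>, and locally Lipschitz in \<open>x\<close>, and by hypothesis \<open>sup |V t|\<close> is integrable in \<open>t\<close>. So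
  trajectories exist, are unique, and extend continuously to \<open>t = 1\<close>. The substitution
  \<open>\<tau> = exp (- (s - t))\<close> identifies \<open>L_{s,s} x\<close> with the value at time \<open>1\<close> of the trajectory of \<open>V\<close>
  that starts from \<open>x\<close> at time \<open>exp (- s)\<close>. As the starting time tends to \<open>0\<close> these trajectories
  converge to the one that starts at time \<open>0\<close>: up to a time \<open>T < 1\<close> by Gronwall, and beyond \<open>T\<close>
  because the integral of \<open>sup |V t|\<close> over \<open>[T, 1]\<close> is small.\<close>

section \<open>Ordinary differential equations with an integrably bounded field\<close>

text \<open>Banach's fixed point theorem on bounded continuous functions. The unknown is the
  solution times \<open>exp (- K * (t - a))\<close>; with this weight the integral operator
  contracts by the factor \<open>L / K\<close> on all of \<open>{a..b}\<close> at once, so no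
  continuation over short intervals is needed.\<close>

lemma picard_lindelof_lipschitz:
  fixes F :: "real \<Rightarrow> 'a::euclidean_space \<Rightarrow> 'a"
  assumes ab: "a \<le> b"
    and cont: "continuous_on ({a..b} \<times> UNIV) (\<lambda>(t, x). F t x)"
    and lip: "\<And>t. t \<in> {a..b} \<Longrightarrow> L-lipschitz_on UNIV (F t)"
  obtains X where "X a = x0"
    "\<And>t. t \<in> {a..b} \<Longrightarrow> (X has_vector_derivative F t (X t)) (at t within {a..b})"
proof -
  \<comment> \<open>Any \<open>K > L\<close> makes the factor \<open>L / K\<close> smaller than 1,
    and the summand 1 keeps \<open>K\<close> positive when \<open>L\<close> is 0.\<close>
  define K where "K = L + 1"
  have L0: "0 \<le> L" using lip[of a] ab lipschitz_on_nonneg by auto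
  then have K0: "0 < K" by (simp add: K_def)
  \<comment> \<open>Clamping the time to \<open>{a..b}\<close> extends functions on the interval to
    bounded continuous functions on the whole line, as the type of the fixed point requires.\<close>
  define c where "c t = max a (min b t)" for t
  have c_mem: "c t \<in> {a..b}" for t using ab by (auto simp: c_def)
  have c_id: "c t = t" if "t \<in> {a..b}" for t using that by (auto simp: c_def)
  have c_cont: "continuous_on S c" for S unfolding c_def by (intro continuous_intros)
  define I where "I Y s = F s (exp (K * (s - a)) *\<^sub>R apply_bcontfun Y s)" for Y s
  have I_cont: "continuous_on {a..b} (I Y)" for Y
    unfolding I_def
    by (rule continuous_on_compose2[OF cont, where f = "\<lambda>s. (s, exp (K * (s - a)) *\<^sub>R apply_bcontfun Y s)", simplified])
       (intro continuous_intros | simp | force)+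
  have I_int: "I Y integrable_on {a..t}" if "t \<in> {a..b}" for Y t
    using that by (intro integrable_continuous_real continuous_on_subset[OF I_cont]) auto
  define G where "G Y \<tau> = exp (- K * (\<tau> - a)) *\<^sub>R (x0 + integral {a..\<tau>} (I Y))" for Y \<tau>
  have G_cont: "continuous_on {a..b} (G Y)" for Y
    unfolding G_def
    by (intro continuous_intros indefinite_integral_continuous_1 I_int) (use ab in auto)
  have Gc_bcontfun: "(\<lambda>t. G Y (c t)) \<in> bcontfun" for Y
  proof -
    have "continuous_on UNIV (\<lambda>t. G Y (c t))"
      by (rule continuous_on_compose2[OF G_cont c_cont]) (use c_mem in auto)
    moreover have "bounded (range (\<lambda>t. G Y (c t)))"
      by (rule bounded_subset[OF compact_imp_bounded[OF compact_continuous_image[OF G_cont compact_Icc]]])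
         (use c_mem in auto)
    ultimately show ?thesis by (simp add: bcontfun_def)
  qed
  define \<Phi> where "\<Phi> Y = Bcontfun (\<lambda>t. G Y (c t))" for Y
  have \<Phi>_apply: "apply_bcontfun (\<Phi> Y) t = G Y (c t)" for Y t
    by (simp add: \<Phi>_def Bcontfun_inverse[OF Gc_bcontfun])
  have contraction: "dist (\<Phi> Y) (\<Phi> Z) \<le> L / K * dist Y Z" for Y Z
  proof (rule dist_bound)
    fix t
    define \<tau> where "\<tau> = c t"
    have \<tau>: "\<tau> \<in> {a..b}" using c_mem by (simp add: \<tau>_def)
    let ?E = "\<lambda>s. exp (K * (s - a))"
    have "((\<lambda>s. L * dist Y Z * ?E s) has_integral L * dist Y Z * (?E \<tau> / K) - L * dist Y Z * (?E a / K)) {a..\<tau>}"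
      using \<tau> K0
      by (intro fundamental_theorem_of_calculus)
         (auto intro!: derivative_eq_intros simp flip: has_real_derivative_iff_has_vector_derivative)
    note E_int = this
    have "norm (integral {a..\<tau>} (\<lambda>s. I Y s - I Z s)) \<le> integral {a..\<tau>} (\<lambda>s. L * dist Y Z * ?E s)"
    proof (rule integral_norm_bound_integral)
      show "(\<lambda>s. I Y s - I Z s) integrable_on {a..\<tau>}" using I_int[OF \<tau>] by (intro integrable_diff)
      show "(\<lambda>s. L * dist Y Z * ?E s) integrable_on {a..\<tau>}" using E_int by blast
      fix s assume s: "s \<in> {a..\<tau>}"
      then have "norm (I Y s - I Z s) \<le> L * dist (?E s *\<^sub>R apply_bcontfun Y s) (?E s *\<^sub>R apply_bcontfun Z s)"
        using lipschitz_onD[OF lip, of s] \<tau> by (auto simp: I_def dist_norm)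
      also have "\<dots> = L * (?E s * dist (apply_bcontfun Y s) (apply_bcontfun Z s))"
        by (simp add: dist_norm flip: scaleR_diff_right)
      also have "\<dots> \<le> L * (?E s * dist Y Z)"
        using L0 dist_bounded by (intro mult_left_mono) auto
      finally show "norm (I Y s - I Z s) \<le> L * dist Y Z * ?E s" by (simp add: mult_ac)
    qed
    also have "\<dots> = L / K * dist Y Z * (?E \<tau> - 1)"
      unfolding integral_unique[OF E_int] using K0 by (simp add: field_simps)
    also have "\<dots> \<le> L / K * dist Y Z * ?E \<tau>"
      using L0 K0 by (intro mult_left_mono) auto
    finally have *: "norm (integral {a..\<tau>} (\<lambda>s. I Y s - I Z s)) \<le> L / K * dist Y Z * ?E \<tau>" .
    have "dist (apply_bcontfun (\<Phi> Y) t) (apply_bcontfun (\<Phi> Z) t)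
        = exp (- K * (\<tau> - a)) * norm (integral {a..\<tau>} (\<lambda>s. I Y s - I Z s))"
      using I_int[OF \<tau>]
      by (simp add: \<Phi>_apply G_def dist_norm integral_diff flip: \<tau>_def scaleR_diff_right)
    also have "\<dots> \<le> exp (- K * (\<tau> - a)) * (L / K * dist Y Z * ?E \<tau>)"
      by (intro mult_left_mono *) auto
    also have "\<dots> = L / K * dist Y Z * (exp (- K * (\<tau> - a)) * ?E \<tau>)" by (simp only: mult_ac)
    also have "exp (- K * (\<tau> - a)) * ?E \<tau> = 1" by (simp flip: exp_add)
    finally show "dist (apply_bcontfun (\<Phi> Y) t) (apply_bcontfun (\<Phi> Z) t) \<le> L / K * dist Y Z" by simp
  qed
  have "\<exists>!Y. \<Phi> Y = Y"
    by (rule banach_fix_type[where c = "L / K"]) (use L0 contraction in \<open>auto simp: K_def\<close>)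
  then obtain Y where Y: "\<Phi> Y = Y" by blast
  \<comment> \<open>Removing the weight from the fixed point \<open>Y\<close> gives \<open>X\<close>
    on \<open>{a..b}\<close>, and the integral form makes \<open>X\<close> differentiable.\<close>
  define X where "X t = x0 + integral {a..t} (I Y)" for t
  have Y_eq: "exp (K * (t - a)) *\<^sub>R apply_bcontfun Y t = X t" if "t \<in> {a..b}" for t
  proof -
    have "apply_bcontfun Y t = exp (- K * (t - a)) *\<^sub>R X t"
      using \<Phi>_apply[of Y t] Y c_id[OF that] by (simp add: G_def X_def)
    then show ?thesis by (simp flip: exp_add)
  qed
  show thesis
  proof
    show "X a = x0" by (simp add: X_def)
    fix t assume t: "t \<in> {a..b}"
    have "(X has_vector_derivative I Y t) (at t within {a..b})"
      unfolding X_def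
      by (auto intro!: derivative_eq_intros integral_has_vector_derivative I_cont t)
    then show "(X has_vector_derivative F t (X t)) (at t within {a..b})"
      using Y_eq[OF t] by (simp add: I_def)
  qed
qed

text \<open>Gronwall: \<open>exp (- 2 * L * (t - a))\<close> times the squared distance of the
  trajectories is nonincreasing. The Lipschitz bound is assumed only along the two trajectories, so
  that locally Lipschitz fields are covered.\<close>

lemma ode_stability:
  fixes X Y :: "real \<Rightarrow> 'a::euclidean_space"
  assumes ab: "a \<le> b"
    and X: "\<And>t. t \<in> {a..b} \<Longrightarrow> (X has_vector_derivative F t (X t)) (at t within {a..b})"
    and Y: "\<And>t. t \<in> {a..b} \<Longrightarrow> (Y has_vector_derivative F t (Y t)) (at t within {a..b})"
    and lip: "\<And>t. t \<in> {a..b} \<Longrightarrow> norm (F t (X t) - F t (Y t)) \<le> L * norm (X t - Y t)"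
  shows "norm (X b - Y b) \<le> exp (L * (b - a)) * norm (X a - Y a)"
proof -
  define D where "D t = X t - Y t" for t
  define D' where "D' t = F t (X t) - F t (Y t)" for t
  have D: "(D has_vector_derivative D' t) (at t within {a..b})" if "t \<in> {a..b}" for t
    unfolding D_def D'_def by (intro has_vector_derivative_diff X Y that)
  have D_cont: "continuous_on {a..b} D"
    using D has_vector_derivative_continuous unfolding continuous_on_eq_continuous_within by blast
  let ?g = "\<lambda>t. exp (- 2 * L * (t - a)) * (D t \<bullet> D t)"
  have "?g b \<le> ?g a"
  proof (rule DERIV_nonpos_imp_decreasing_open[OF ab])
    show "continuous_on {a..b} ?g" by (intro continuous_intros D_cont)
    fix t assume t: "a < t" "t < b"
    then have "at t within {a..b} = at t" by (rule at_within_Icc_at)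
    with D[of t] t have "(D has_derivative (\<lambda>h. h *\<^sub>R D' t)) (at t)"
      by (simp add: has_vector_derivative_def)
    then have "(?g has_real_derivative
        exp (- 2 * L * (t - a)) * (- 2 * L) * (D t \<bullet> D t) + exp (- 2 * L * (t - a)) * (2 * (D t \<bullet> D' t))) (at t)"
      unfolding has_field_derivative_def
      by (auto intro!: derivative_eq_intros simp: fun_eq_iff algebra_simps inner_commute)
    moreover have "D t \<bullet> D' t \<le> L * (D t \<bullet> D t)"
    proof -
      have "D t \<bullet> D' t \<le> norm (D t) * norm (D' t)" by (rule norm_cauchy_schwarz)
      also have "\<dots> \<le> norm (D t) * (L * norm (D t))"
        using lip[of t] t by (intro mult_left_mono) (auto simp: D_def D'_def)
      finally show ?thesis by (simp add: dot_square_norm power2_eq_square mult_ac)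
    qed
    then have "exp (- 2 * L * (t - a)) * (- 2 * L) * (D t \<bullet> D t) + exp (- 2 * L * (t - a)) * (2 * (D t \<bullet> D' t)) \<le> 0"
      by (auto simp: algebra_simps)
    ultimately show "\<exists>y. (?g has_real_derivative y) (at t) \<and> y \<le> 0" by blast
  qed
  then have "exp (2 * L * (b - a)) * ?g b \<le> exp (2 * L * (b - a)) * (D a \<bullet> D a)"
    by (intro mult_left_mono) auto
  then have "D b \<bullet> D b \<le> exp (2 * L * (b - a)) * (D a \<bullet> D a)"
    by (simp add: mult.assoc[symmetric] flip: exp_add)
  also have "exp (2 * L * (b - a)) = (exp (L * (b - a)))\<^sup>2"
    by (simp add: power2_eq_square flip: exp_add)
  finally have "(norm (D b))\<^sup>2 \<le> (exp (L * (b - a)) * norm (D a))\<^sup>2"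
    by (simp add: dot_square_norm power_mult_distrib)
  then show ?thesis unfolding D_def by (rule power2_le_imp_le) simp
qed

section \<open>Trajectories of a field bounded by an integrable function of time\<close>

text \<open>An abstraction of the velocity field: the Lipschitz constants may blow up as
  \<open>T\<close> tends to 1, and \<open>N\<close> collects the times at which the spatial bound
  may fail.\<close>

locale integrably_bounded_field =
  fixes V :: "real \<Rightarrow> 'a::euclidean_space \<Rightarrow> 'a" and m :: "real \<Rightarrow> real" and N :: "real set"
  assumes cont: "continuous_on ({0..<1} \<times> UNIV) (\<lambda>(t, x). V t x)"
    and lip: "T < 1 \<Longrightarrow> \<exists>L. \<forall>t\<in>{0..T}. L-lipschitz_on (cball 0 R) (V t)"
    and int: "m integrable_on {0..1}"
    and nonneg: "0 \<le> m t"
    and negl: "negligible N"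
    and bound: "t \<in> {0..<1} - N \<Longrightarrow> norm (V t x) \<le> m t"
begin

text \<open>The increments of \<open>\<Lambda>\<close> bound those of every trajectory, so it serves
  as a common modulus of continuity up to time 1.\<close>

definition \<Lambda> where "\<Lambda> t = integral {0..t} m"

definition solution :: "real \<Rightarrow> (real \<Rightarrow> 'a) \<Rightarrow> bool" where
  "solution a X \<longleftrightarrow> continuous_on {a..1} X \<and>
     (\<forall>t\<in>{a..<1}. (X has_vector_derivative V t (X t)) (at t within {a..1}))"

lemma continuous_\<Lambda>: "continuous_on {0..1} \<Lambda>"
  unfolding \<Lambda>_def by (rule indefinite_integral_continuous_1[OF int])

lemma int_sub: "0 \<le> a \<Longrightarrow> b \<le> 1 \<Longrightarrow> m integrable_on {a..b}"
  by (rule integrable_subinterval_real[OF int]) auto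

lemma \<Lambda>_diff:
  assumes "0 \<le> a" "a \<le> b" "b \<le> 1"
  shows "\<Lambda> b - \<Lambda> a = integral {a..b} m"
  using Henstock_Kurzweil_Integration.integral_combine[of 0 a b m] assms int_sub[of 0 b]
  by (simp add: \<Lambda>_def)

lemma \<Lambda>_mono:
  assumes "0 \<le> a" "a \<le> b" "b \<le> 1"
  shows "\<Lambda> a \<le> \<Lambda> b"
  using \<Lambda>_diff[OF assms] integral_nonneg[OF int_sub, of a b] nonneg assms by simp

lemma \<Lambda>_nonneg: "0 \<le> t \<Longrightarrow> t \<le> 1 \<Longrightarrow> 0 \<le> \<Lambda> t"
  using \<Lambda>_mono[of 0 t] by (simp add: \<Lambda>_def)

text \<open>Integrate the bound on the speed. The field is evaluated at a separate curve
  \<open>Y\<close> so that the bound also applies when the trajectory is first projected onto a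
  ball, as in \<open>local_exists\<close>.\<close>

lemma increment_bound:
  assumes ab: "0 \<le> a" "a \<le> s" "s \<le> t" "t \<le> b" "b < 1"
    and X: "\<And>u. u \<in> {a..b} \<Longrightarrow> (X has_vector_derivative V u (Y u)) (at u within {a..b})"
  shows "norm (X t - X s) \<le> \<Lambda> t - \<Lambda> s"
proof -
  \<comment> \<open>Setting both integrands to 0 on the negligible set \<open>N\<close> keeps their
    integrals and makes the pointwise bound hold at every time.\<close>
  define W where "W u = (if u \<in> N then 0 else V u (Y u))" for u
  define m' where "m' u = (if u \<in> N then 0 else m u)" for u
  have "((\<lambda>u. V u (Y u)) has_integral X t - X s) {s..t}"
  proof (rule fundamental_theorem_of_calculus)
    fix u assume "u \<in> {s..t}"
    then show "(X has_vector_derivative V u (Y u)) (at u within {s..t})"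
      using ab by (intro has_vector_derivative_within_subset[OF X]) auto
  qed (use ab in auto)
  then have W: "(W has_integral X t - X s) {s..t}"
    by (rule has_integral_spike[OF negl, rotated]) (auto simp: W_def)
  have "(m has_integral \<Lambda> t - \<Lambda> s) {s..t}"
    using \<Lambda>_diff int_sub ab by (simp add: has_integral_integral)
  then have m': "(m' has_integral \<Lambda> t - \<Lambda> s) {s..t}"
    by (rule has_integral_spike[OF negl, rotated]) (auto simp: m'_def)
  have "norm (integral {s..t} W) \<le> integral {s..t} m'"
  proof (rule integral_norm_bound_integral)
    show "norm (W u) \<le> m' u" if "u \<in> {s..t}" for u
      using bound[of u] ab that by (auto simp: W_def m'_def)
  qed (use W m' in auto)
  with W m' show ?thesis by (simp add: integral_unique)
qed

definition solves_on :: "real \<Rightarrow> real \<Rightarrow> (real \<Rightarrow> 'a) \<Rightarrow> bool" where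
  "solves_on a b X \<longleftrightarrow> (\<forall>t\<in>{a..b}. (X has_vector_derivative V t (X t)) (at t within {a..b}))"

lemma solves_onD:
  "solves_on a b X \<Longrightarrow> t \<in> {a..b} \<Longrightarrow> (X has_vector_derivative V t (X t)) (at t within {a..b})"
  by (simp add: solves_on_def)

lemma solves_on_subset:
  assumes "solves_on a b X" "a \<le> s" "t \<le> b"
  shows "solves_on s t X"
  unfolding solves_on_def
proof
  fix u assume "u \<in> {s..t}"
  with assms show "(X has_vector_derivative V u (X u)) (at u within {s..t})"
    by (intro has_vector_derivative_within_subset[OF solves_onD[OF assms(1)]]) auto
qed

lemma solves_on_increment:
  assumes "solves_on a b X" "0 \<le> a" "a \<le> s" "s \<le> t" "t \<le> b" "b < 1"
  shows "norm (X t - X s) \<le> \<Lambda> t - \<Lambda> s"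
  using increment_bound[OF assms(2-6) solves_onD[OF assms(1)]] .

lemma solves_on_norm_le:
  assumes "solves_on a b X" "0 \<le> a" "b < 1" "t \<in> {a..b}"
  shows "norm (X t) \<le> norm (X a) + \<Lambda> 1"
proof -
  have "norm (X t - X a) \<le> \<Lambda> t - \<Lambda> a"
    using assms by (intro solves_on_increment[OF assms(1)]) auto
  moreover have "\<Lambda> t \<le> \<Lambda> 1" "0 \<le> \<Lambda> a"
    using assms by (auto intro!: \<Lambda>_mono \<Lambda>_nonneg)
  moreover have "norm (X t) \<le> norm (X a) + norm (X t - X a)" by (rule norm_triangle_sub)
  ultimately show ?thesis by linarith
qed

lemma solution_solves_on:
  assumes "solution a X" "a \<le> s" "b < 1"
  shows "solves_on s b X"
  unfolding solves_on_def
proof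
  fix t assume "t \<in> {s..b}"
  then have "(X has_vector_derivative V t (X t)) (at t within {a..1})"
    using assms by (simp add: solution_def)
  then show "(X has_vector_derivative V t (X t)) (at t within {s..b})"
    by (rule has_vector_derivative_within_subset) (use assms in auto)
qed

text \<open>The bound is known before time 1 and passes to \<open>t = 1\<close> because both sides
  are continuous there.\<close>

lemma solution_increment:
  assumes X: "solution a X" and st: "0 \<le> a" "a \<le> s" "s \<le> t" "t \<le> 1"
  shows "norm (X t - X s) \<le> \<Lambda> t - \<Lambda> s"
proof -
  have *: "norm (X u - X s) \<le> \<Lambda> u - \<Lambda> s" if "s \<le> u" "u < 1" for u
    using st that by (intro solves_on_increment[OF solution_solves_on[OF X]]) auto
  consider "t < 1" | "s = 1" "t = 1" | "s < 1" "t = 1" using st by linarith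
  then show ?thesis
  proof cases
    case 3
    have "continuous_on {s..1} X" "continuous_on {s..1} \<Lambda>"
      using X st by (auto simp: solution_def intro: continuous_on_subset continuous_on_subset[OF continuous_\<Lambda>])
    then have "continuous_on (closure {s..<1}) (\<lambda>u. \<Lambda> u - \<Lambda> s - norm (X u - X s))"
      using 3 by (auto intro!: continuous_intros)
    then have "0 \<le> \<Lambda> 1 - \<Lambda> s - norm (X 1 - X s)"
      by (rule continuous_ge_on_closure) (use 3 * in auto)
    with 3 show ?thesis by simp
  qed (use * st in auto)
qed

text \<open>All trajectories starting in the ball of radius \<open>R\<close> stay in the ball of
  radius \<open>R + \<Lambda> 1\<close>, where the field has one Lipschitz constant up to time
  \<open>T\<close>. One \<open>L\<close> thus serves every starting time \<open>a\<close>, which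
  matters when starting times tend to 0.\<close>

lemma uniform_stability:
  assumes "T < 1"
  obtains L where
    "\<And>a X Y. 0 \<le> a \<Longrightarrow> a \<le> T \<Longrightarrow> solves_on a T X \<Longrightarrow> solves_on a T Y \<Longrightarrow>
      norm (X a) \<le> R \<Longrightarrow> norm (Y a) \<le> R \<Longrightarrow> norm (X T - Y T) \<le> exp L * norm (X a - Y a)"
proof -
  obtain L where L: "\<And>t. t \<in> {0..T} \<Longrightarrow> L-lipschitz_on (cball 0 (R + \<Lambda> 1)) (V t)"
    using lip[OF assms] by blast
  show thesis
  proof
    fix a X Y
    assume a: "0 \<le> a" "a \<le> T" and X: "solves_on a T X" and Y: "solves_on a T Y"
      and R: "norm (X a) \<le> R" "norm (Y a) \<le> R"
    have "norm (X T - Y T) \<le> exp (L * (T - a)) * norm (X a - Y a)"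
    proof (rule ode_stability[OF a(2) solves_onD[OF X] solves_onD[OF Y]])
      fix t assume t: "t \<in> {a..T}"
      have "X t \<in> cball 0 (R + \<Lambda> 1)" "Y t \<in> cball 0 (R + \<Lambda> 1)"
        using solves_on_norm_le[OF X a(1) assms t] solves_on_norm_le[OF Y a(1) assms t] R by auto
      then show "norm (V t (X t) - V t (Y t)) \<le> L * norm (X t - Y t)"
        using lipschitz_onD[OF L[of t]] t a by (simp add: dist_norm)
    qed
    also have "L * (T - a) \<le> L * 1"
      using a assms lipschitz_on_nonneg[OF L[of T]] by (intro mult_left_mono) auto
    then have "exp (L * (T - a)) * norm (X a - Y a) \<le> exp L * norm (X a - Y a)"
      by (intro mult_right_mono) auto
    finally show "norm (X T - Y T) \<le> exp L * norm (X a - Y a)" .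
  qed
qed

lemma solves_on_unique:
  assumes "0 \<le> a" "a \<le> T" "T < 1" "solves_on a T X" "solves_on a T Y" "X a = Y a"
  shows "X T = Y T"
proof -
  show ?thesis
  proof (rule uniform_stability[OF assms(3), of "norm (X a)"])
    fix L
    assume "\<And>a' X' Y'. 0 \<le> a' \<Longrightarrow> a' \<le> T \<Longrightarrow> solves_on a' T X' \<Longrightarrow> solves_on a' T Y' \<Longrightarrow>
      norm (X' a') \<le> norm (X a) \<Longrightarrow> norm (Y' a') \<le> norm (X a) \<Longrightarrow>
      norm (X' T - Y' T) \<le> exp L * norm (X' a' - Y' a')"
    from this[OF assms(1,2,4,5)] assms(6) show ?thesis by simp
  qed
qed

lemma solution_unique:
  assumes "solution a X" "solution a Y" "X a = Y a" "0 \<le> a" "a < 1" "t \<in> {a..1}"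
  shows "X t = Y t"
proof -
  have *: "X u - Y u = 0" if "u \<in> {a..<1}" for u
    using solves_on_unique[of a u X Y] solution_solves_on[of a _ a u] assms that by simp
  have "continuous_on (closure {a..<1}) (\<lambda>u. X u - Y u)"
    using assms by (auto simp: solution_def intro!: continuous_intros)
  from continuous_constant_on_closure[OF this *] show ?thesis using assms by auto
qed

text \<open>Composing the field with the nearest-point projection onto a ball makes it globally
  Lipschitz. The radius \<open>norm x + \<Lambda> 1\<close> is chosen so that the increment bound
  keeps the resulting trajectory inside the ball, where the projection is the identity.\<close>

lemma local_exists:
  assumes aT: "0 \<le> a" "a \<le> T" "T < 1"
  shows "\<exists>X. X a = x \<and> solves_on a T X"
proof -
  define R where "R = norm x + \<Lambda> 1"
  have R0: "0 \<le> R" using \<Lambda>_nonneg[of 1] by (simp add: R_def)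
  let ?P = "closest_point (cball (0::'a) R)"
  have P_mem: "?P y \<in> cball 0 R" for y using R0 by (intro closest_point_in_set) auto
  obtain L where L: "\<And>t. t \<in> {0..T} \<Longrightarrow> L-lipschitz_on (cball 0 R) (V t)"
    using lip[OF aT(3)] by blast
  have P_lip: "1-lipschitz_on UNIV ?P"
    using R0 by (intro lipschitz_onI) (auto intro!: closest_point_lipschitz)
  have "continuous_on ({a..T} \<times> UNIV) (\<lambda>z. (\<lambda>(t, y). V t y) (fst z, ?P (snd z)))"
  proof (rule continuous_on_compose2[OF cont])
    show "continuous_on ({a..T} \<times> UNIV) (\<lambda>z. (fst z, ?P (snd z)))"
      by (intro continuous_intros continuous_on_compose2[OF lipschitz_on_continuous_on[OF P_lip]]) auto
  qed (use aT in auto)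
  then have F_cont: "continuous_on ({a..T} \<times> UNIV) (\<lambda>(t, y). V t (?P y))"
    by (simp add: case_prod_beta)
  have F_lip: "L-lipschitz_on UNIV (\<lambda>y. V t (?P y))" if "t \<in> {a..T}" for t
    using lipschitz_on_compose2[OF P_lip lipschitz_on_subset[OF L[of t] image_subsetI[OF P_mem]]] that aT
    by simp
  obtain X where X0: "X a = x"
    and X: "\<And>t. t \<in> {a..T} \<Longrightarrow> (X has_vector_derivative V t (?P (X t))) (at t within {a..T})"
    using picard_lindelof_lipschitz[OF aT(2) F_cont F_lip, of x] by blast
  have "?P (X t) = X t" if t: "t \<in> {a..T}" for t
  proof (rule closest_point_self)
    have "norm (X t - X a) \<le> \<Lambda> t - \<Lambda> a"
      using t aT by (intro increment_bound[OF _ _ _ _ _ X]) auto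
    moreover have "\<Lambda> t \<le> \<Lambda> 1" "0 \<le> \<Lambda> a"
      using t aT by (auto intro!: \<Lambda>_mono \<Lambda>_nonneg)
    moreover have "norm (X t) \<le> norm (X a) + norm (X t - X a)" by (rule norm_triangle_sub)
    ultimately show "X t \<in> cball 0 R" by (simp add: R_def X0)
  qed
  with X have "solves_on a T X" by (simp add: solves_on_def)
  with X0 show ?thesis by blast
qed

text \<open>Solutions up to each \<open>T < 1\<close> agree by uniqueness and glue together. The
  result inherits uniform continuity from \<open>\<Lambda>\<close> and therefore extends
  continuously to time 1.\<close>

lemma solution_exists:
  assumes a: "0 \<le> a" "a < 1"
  obtains X where "solution a X" "X a = x"
proof -
  have "\<forall>T\<in>{a..<1}. \<exists>X. X a = x \<and> solves_on a T X"
    using local_exists a by auto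
  from bchoice[OF this] obtain Z where Z0: "\<And>T. T \<in> {a..<1} \<Longrightarrow> Z T a = x"
    and Z: "\<And>T. T \<in> {a..<1} \<Longrightarrow> solves_on a T (Z T)"
    by blast
  define X where "X t = Z t t" for t
  have X_eq: "X t = Z T t" if "t \<in> {a..T}" "T < 1" for t T
    unfolding X_def using that a
    by (intro solves_on_unique[of a t "Z t" "Z T"] Z solves_on_subset[OF Z]) (auto simp: Z0)
  \<comment> \<open>Differentiability at a time \<open>t < T\<close> does not see the right end of
    the interval, so the three one-sided filters agree.\<close>
  have nhd: "at t within {a..T} = at t within {a..<1}" "at t within {a..<1} = at t within {a..1}"
    if "t < T" "T < 1" for t T
    using that by (auto intro!: at_within_nhd[of t "{..<T}"])
  have X: "solves_on a T X" if "a \<le> T" "T < 1" for T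
    unfolding solves_on_def
  proof
    fix t assume t: "t \<in> {a..T}"
    show "(X has_vector_derivative V t (X t)) (at t within {a..T})"
    proof (rule has_vector_derivative_transform[of _ _ _ "Z T"])
      show "(Z T has_vector_derivative V t (X t)) (at t within {a..T})"
        using solves_onD[OF Z[of T] t] that X_eq[OF t that(2)] by simp
    qed (use t that X_eq in auto)
  qed
  have X_incr: "norm (X t - X s) \<le> \<Lambda> t - \<Lambda> s" if "a \<le> s" "s \<le> t" "t < 1" for s t
    using that a by (intro solves_on_increment[OF X]) auto
  have X_dist: "dist (X t) (X s) \<le> dist (\<Lambda> t) (\<Lambda> s)" if "s \<in> {a..<1}" "t \<in> {a..<1}" for s t
    using X_incr[of s t] X_incr[of t s] that by (cases "s \<le> t") (auto simp: dist_norm norm_minus_commute)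
  have "uniformly_continuous_on {a..1} \<Lambda>"
    using a by (intro compact_uniformly_continuous continuous_on_subset[OF continuous_\<Lambda>]) auto
  then have "uniformly_continuous_on {a..<1} \<Lambda>"
    unfolding uniformly_continuous_on_def by (meson atLeastAtMost_iff atLeastLessThan_iff less_imp_le)
  then have "uniformly_continuous_on {a..<1} X"
    using X_dist unfolding uniformly_continuous_on_def by (meson le_less_trans)
  then obtain g where g_cont: "uniformly_continuous_on (closure {a..<1}) g"
    and g_eq: "\<And>t. t \<in> {a..<1} \<Longrightarrow> X t = g t"
    using uniformly_continuous_on_extension_on_closure by metis
  have "solution a g"
    unfolding solution_def
  proof (intro conjI ballI)
    show "continuous_on {a..1} g"
      using uniformly_continuous_imp_continuous[OF g_cont] a by simp
    fix t assume t: "t \<in> {a..<1}"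
    let ?T = "(t + 1) / 2"
    have T: "t < ?T" "?T < 1" using t by auto
    have "(X has_vector_derivative V t (X t)) (at t within {a..<1})"
      using solves_onD[OF X[of ?T], of t] t nhd(1)[OF T] T by simp
    then have "(g has_vector_derivative V t (X t)) (at t within {a..<1})"
      by (rule has_vector_derivative_transform[rotated 2]) (use t g_eq in auto)
    then show "(g has_vector_derivative V t (g t)) (at t within {a..1})"
      using nhd(2)[OF T] g_eq[OF t] by simp
  qed
  moreover have "g a = x" using g_eq[of a] a Z0[of a] by (simp add: X_def)
  ultimately show thesis by (rule that)
qed

text \<open>Near the endpoint \<open>1\<close> the Lipschitz constants from \<open>lip\<close> may blow up; there the tail of \<open>\<Lambda>\<close>
  controls all solutions simultaneously.\<close>

lemma solution_start_tendsto:
  assumes X: "solution 0 X" "X 0 = x"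
    and Z: "\<And>\<epsilon>. 0 < \<epsilon> \<Longrightarrow> \<epsilon> < 1 \<Longrightarrow> solution \<epsilon> (Z \<epsilon>)" "\<And>\<epsilon>. 0 < \<epsilon> \<Longrightarrow> \<epsilon> < 1 \<Longrightarrow> Z \<epsilon> \<epsilon> = x"
  shows "((\<lambda>\<epsilon>. Z \<epsilon> 1) \<longlongrightarrow> X 1) (at_right 0)"
proof (rule tendstoI)
  fix e :: real assume e: "0 < e"
  obtain d where d: "0 < d" "\<And>t. t \<in> {0..1} \<Longrightarrow> dist t 1 < d \<Longrightarrow> dist (\<Lambda> t) (\<Lambda> 1) < e / 3"
    using continuous_\<Lambda> e unfolding continuous_on_iff by (metis atLeastAtMost_iff divide_pos_pos order_refl zero_le_one zero_less_numeral)
  \<comment> \<open>Within \<open>d\<close> of 1, so that the tail of \<open>\<Lambda>\<close> after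
    \<open>T\<close> is below \<open>e / 3\<close>; the value \<open>1 / 2\<close> keeps
    \<open>T\<close> positive when \<open>d\<close> is large.\<close>
  define T where "T = max (1 / 2) (1 - d / 2)"
  have T: "0 < T" "T < 1" "dist T 1 < d" using d by (auto simp: T_def dist_real_def)
  have tail: "\<Lambda> 1 - \<Lambda> T < e / 3"
    using d(2)[of T] T abs_ge_minus_self[of "\<Lambda> T - \<Lambda> 1"] by (simp add: dist_real_def)
  obtain L where L: "\<And>a X Y. 0 \<le> a \<Longrightarrow> a \<le> T \<Longrightarrow> solves_on a T X \<Longrightarrow> solves_on a T Y \<Longrightarrow>
      norm (X a) \<le> norm x + \<Lambda> 1 \<Longrightarrow> norm (Y a) \<le> norm x + \<Lambda> 1 \<Longrightarrow>
      norm (X T - Y T) \<le> exp L * norm (X a - Y a)"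
    using uniform_stability[OF T(2)] by blast
  \<comment> \<open>The initial discrepancy at time \<epsilon> is amplified by at most
    \<open>exp L\<close> up to time \<open>T\<close>, hence the division. The two tails supply the
    other two thirds of \<open>e\<close>.\<close>
  obtain d' where d': "0 < d'" "\<And>t. t \<in> {0..1} \<Longrightarrow> dist t 0 < d' \<Longrightarrow> dist (\<Lambda> t) (\<Lambda> 0) < e / 3 / exp L"
    using continuous_\<Lambda> e unfolding continuous_on_iff by (metis atLeastAtMost_iff divide_pos_pos exp_gt_zero order_refl zero_le_one zero_less_numeral)
  have "dist (Z \<epsilon> 1) (X 1) < e" if \<epsilon>: "0 < \<epsilon>" "\<epsilon> < min d' T" for \<epsilon>
  proof -
    have Z\<epsilon>: "solution \<epsilon> (Z \<epsilon>)" "Z \<epsilon> \<epsilon> = x" using Z \<epsilon> T by auto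
    have X\<epsilon>: "norm (X \<epsilon> - x) \<le> \<Lambda> \<epsilon> - \<Lambda> 0"
      using solution_increment[OF X(1), of 0 \<epsilon>] X(2) \<epsilon> T by simp
    have "norm (X \<epsilon>) \<le> norm x + norm (X \<epsilon> - x)" by (rule norm_triangle_sub)
    also have "\<dots> \<le> norm x + \<Lambda> 1"
      using X\<epsilon> \<Lambda>_mono[of \<epsilon> 1] \<Lambda>_nonneg[of 0] \<epsilon> T by simp
    finally have "norm (Z \<epsilon> T - X T) \<le> exp L * norm (Z \<epsilon> \<epsilon> - X \<epsilon>)"
      using \<epsilon> T \<Lambda>_nonneg[of 1] Z\<epsilon>(2)
      by (intro L solution_solves_on[OF Z\<epsilon>(1)] solution_solves_on[OF X(1)]) auto
    also have "\<dots> \<le> exp L * (\<Lambda> \<epsilon> - \<Lambda> 0)"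
      using X\<epsilon> Z\<epsilon> by (simp add: norm_minus_commute)
    also have "\<dots> < exp L * (e / 3 / exp L)"
      using d'(2)[of \<epsilon>] \<epsilon> T by (intro mult_strict_left_mono) (auto simp: dist_real_def)
    finally have "norm (Z \<epsilon> T - X T) < e / 3" by simp
    moreover have "norm (Z \<epsilon> 1 - Z \<epsilon> T) \<le> \<Lambda> 1 - \<Lambda> T" "norm (X 1 - X T) \<le> \<Lambda> 1 - \<Lambda> T"
      using \<epsilon> T by (auto intro!: solution_increment[OF Z\<epsilon>(1)] solution_increment[OF X(1)])
    moreover have "dist (Z \<epsilon> 1) (X 1) \<le> dist (Z \<epsilon> 1) (Z \<epsilon> T) + dist (Z \<epsilon> T) (X T) + dist (X 1) (X T)"
      by metric
    ultimately show ?thesis using tail by (simp add: dist_norm)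
  qed
  then show "\<forall>\<^sub>F \<epsilon> in at_right 0. dist (Z \<epsilon> 1) (X 1) < e"
    using d'(1) T unfolding eventually_at_right_field by (intro exI[of _ "min d' T"]) auto
qed

end

section \<open>Gaussian tilts and the velocity field\<close>

lemma continuous_on_lebesgue_integral:
  fixes f :: "'b::{metric_space} \<Rightarrow> 'c \<Rightarrow> 'd::{banach, second_countable_topology}"
  assumes meas: "\<And>z. z \<in> S \<Longrightarrow> f z \<in> borel_measurable M"
    and w: "integrable M w"
    and cont: "\<And>y. y \<in> space M \<Longrightarrow> continuous_on S (\<lambda>z. f z y)"
    and bound: "\<And>z y. z \<in> S \<Longrightarrow> y \<in> space M \<Longrightarrow> norm (f z y) \<le> w y"
  shows "continuous_on S (\<lambda>z. \<integral>y. f z y \<partial>M)"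
  unfolding continuous_on_sequentially
proof (intro allI ballI impI, elim conjE)
  fix X z assume z: "z \<in> S" and X: "\<forall>n. X n \<in> S" "X \<longlonglongrightarrow> z"
  have "(\<lambda>n. \<integral>y. f (X n) y \<partial>M) \<longlonglongrightarrow> (\<integral>y. f z y \<partial>M)"
  proof (rule integral_dominated_convergence[where w = w])
    have "(\<lambda>n. f (X n) y) \<longlonglongrightarrow> f z y" if "y \<in> space M" for y
      using cont[OF that] X z unfolding continuous_on_sequentially by (auto simp: comp_def)
    then show "AE y in M. (\<lambda>n. f (X n) y) \<longlonglongrightarrow> f z y" by simp
  qed (use X z meas w bound in auto)
  then show "((\<lambda>z. \<integral>y. f z y \<partial>M) \<circ> X) \<longlonglongrightarrow> (\<integral>y. f z y \<partial>M)" by (simp add: comp_def)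
qed

lemma mult_exp_minus_le_one: "z * exp (- z) \<le> (1::real)"
proof -
  have "z \<le> exp z" using exp_ge_add_one_self[of z] by linarith
  then show ?thesis by (simp add: exp_minus divide_simps)
qed

text \<open>Mean value inequality. The gradient has norm
  \<open>2 * k * norm a * exp (- k * (norm a)\<^sup>2)\<close>; with
  \<open>norm a \<le> 1 + (norm a)\<^sup>2\<close> and \<open>mult_exp_minus_le_one\<close> this is
  at most \<open>2 * (k + 1)\<close>.\<close>

lemma gaussian_lipschitz:
  fixes a b :: "'a::euclidean_space"
  assumes "0 \<le> k"
  shows "\<bar>exp (- k * (norm a)\<^sup>2) - exp (- k * (norm b)\<^sup>2)\<bar> \<le> (2 * k + 2) * norm (a - b)"
proof -
  let ?g = "\<lambda>a::'a. exp (- k * (a \<bullet> a))"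
  have "norm (?g a - ?g b) \<le> (2 * k + 2) * norm (a - b)"
  proof (rule differentiable_bound[of UNIV ?g "\<lambda>a h. ?g a * (- 2 * k * (a \<bullet> h))"])
    fix a :: 'a
    show "(?g has_derivative (\<lambda>h. ?g a * (- 2 * k * (a \<bullet> h)))) (at a within UNIV)"
      by (auto intro!: derivative_eq_intros simp: fun_eq_iff inner_commute algebra_simps)
    show "onorm (\<lambda>h. ?g a * (- 2 * k * (a \<bullet> h))) \<le> 2 * k + 2"
    proof (rule onorm_bound)
      fix h
      have "norm a \<le> 1 + a \<bullet> a"
      proof -
        have "0 \<le> (norm a - 1)\<^sup>2 + (norm a)\<^sup>2 + 1" by simp
        then show ?thesis by (simp add: dot_square_norm power2_eq_square algebra_simps)
      qed
      then have "k * norm a * ?g a \<le> k * (1 + a \<bullet> a) * ?g a"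
        using assms by (intro mult_right_mono mult_left_mono) auto
      also have "\<dots> = k * ?g a + (k * (a \<bullet> a)) * exp (- (k * (a \<bullet> a)))" by (simp add: algebra_simps)
      also have "\<dots> \<le> k * 1 + 1"
        using assms by (intro add_mono mult_left_mono mult_exp_minus_le_one) auto
      finally have *: "k * norm a * ?g a \<le> k + 1" by simp
      have "norm (?g a * (- 2 * k * (a \<bullet> h))) = 2 * k * ?g a * \<bar>a \<bullet> h\<bar>"
        using assms by (simp add: abs_mult)
      also have "\<dots> \<le> 2 * k * ?g a * (norm a * norm h)"
        using assms by (intro mult_left_mono Cauchy_Schwarz_ineq2) auto
      also have "\<dots> = 2 * (k * norm a * ?g a) * norm h" by simp
      also have "\<dots> \<le> 2 * (k + 1) * norm h"
        using * by (intro mult_right_mono mult_left_mono) auto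
      finally show "norm (?g a * (- 2 * k * (a \<bullet> h))) \<le> (2 * k + 2) * norm h" by (simp add: algebra_simps)
    qed (use assms in auto)
  qed auto
  then show ?thesis by (simp add: dot_square_norm)
qed

text \<open>Second-order Taylor expansion along the segment from \<open>a\<close> to
  \<open>a - h\<close>. The Gaussian factor absorbs the growth of the second derivative, so the
  bound is uniform in \<open>a\<close> and can be integrated when differentiating
  \<open>D\<close>.\<close>

lemma gaussian_quadratic_remainder:
  fixes a h :: "'a::euclidean_space"
  assumes k: "0 \<le> k"
  shows "\<bar>exp (- k * (norm (a - h))\<^sup>2) - exp (- k * (norm a)\<^sup>2) - exp (- k * (norm a)\<^sup>2) * (2 * k * (a \<bullet> h))\<bar>
    \<le> 3 * k * (norm h)\<^sup>2"
proof -
  define c where "c s = a - s *\<^sub>R h" for s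
  define g where "g s = exp (- k * (c s \<bullet> c s))" for s
  define g1 where "g1 s = g s * (2 * k * (c s \<bullet> h))" for s
  define g2 where "g2 s = g s * ((2 * k * (c s \<bullet> h))\<^sup>2 - 2 * k * (h \<bullet> h))" for s
  have c: "(c has_derivative (\<lambda>x. - x *\<^sub>R h)) (at s)" for s
    unfolding c_def by (auto intro!: derivative_eq_intros)
  have g: "(g has_real_derivative g1 s) (at s)" for s
    unfolding g_def has_field_derivative_def
    by (rule derivative_eq_intros c refl)+
       (simp add: g1_def g_def fun_eq_iff inner_commute algebra_simps)
  have g1: "(g1 has_real_derivative g2 s) (at s)" for s
  proof -
    have "((\<lambda>s. 2 * k * (c s \<bullet> h)) has_real_derivative - 2 * k * (h \<bullet> h)) (at s)"
      unfolding has_field_derivative_def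
      by (rule derivative_eq_intros c refl)+ (simp add: fun_eq_iff algebra_simps)
    from DERIV_mult[OF g this] show ?thesis
      unfolding g1_def[abs_def] g2_def by (simp add: algebra_simps power2_eq_square g1_def)
  qed
  \<comment> \<open>The list of derivatives in the form that \<open>Maclaurin\<close> expects; only
    the orders 0, 1 and 2 occur.\<close>
  define diff where "diff n = (if n = 0 then g else if n = Suc 0 then g1 else g2)" for n
  have "\<exists>t>0. t < 1 \<and> g 1 = (\<Sum>m<2. diff m 0 / fact m * 1 ^ m) + diff 2 t / fact 2 * 1 ^ 2"
    using g g1 by (intro Maclaurin) (auto simp: diff_def less_2_cases_iff)
  then obtain t where t: "g 1 - g 0 - g1 0 = g2 t / 2"
    by (auto simp: diff_def numeral_2_eq_2)
  have "\<bar>g2 t\<bar> \<le> g t * ((2 * k * (c t \<bullet> h))\<^sup>2 + 2 * k * (h \<bullet> h))"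
    unfolding g2_def abs_mult using k by (intro mult_mono) (auto simp: g_def abs_le_iff)
  also have "\<dots> \<le> g t * (4 * k\<^sup>2 * ((norm (c t))\<^sup>2 * (norm h)\<^sup>2) + 2 * k * (norm h)\<^sup>2)"
  proof -
    have "\<bar>c t \<bullet> h\<bar>\<^sup>2 \<le> (norm (c t) * norm h)\<^sup>2"
      by (intro power_mono Cauchy_Schwarz_ineq2) auto
    then have "4 * k\<^sup>2 * (c t \<bullet> h)\<^sup>2 \<le> 4 * k\<^sup>2 * ((norm (c t))\<^sup>2 * (norm h)\<^sup>2)"
      by (intro mult_left_mono) (auto simp: power_mult_distrib)
    then show ?thesis
      by (intro mult_left_mono) (auto simp: g_def power_mult_distrib dot_square_norm)
  qed
  also have "\<dots> = 4 * k * (norm h)\<^sup>2 * ((k * (norm (c t))\<^sup>2) * exp (- (k * (norm (c t))\<^sup>2)))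
      + 2 * k * (norm h)\<^sup>2 * g t"
    by (simp add: g_def dot_square_norm algebra_simps power2_eq_square)
  also have "\<dots> \<le> 4 * k * (norm h)\<^sup>2 * 1 + 2 * k * (norm h)\<^sup>2 * 1"
    using k by (intro add_mono mult_left_mono mult_exp_minus_le_one) (auto simp: g_def)
  finally have "\<bar>g 1 - g 0 - g1 0\<bar> \<le> 3 * k * (norm h)\<^sup>2" unfolding t by simp
  then show ?thesis by (simp add: g_def g1_def c_def dot_square_norm)
qed

text \<open>Up to a constant, the density at \<open>x\<close> of
  \<open>t *\<^sub>R y + sqrt (1 - t\<^sup>2) *\<^sub>R z\<close> for a standard Gaussian
  \<open>z\<close>, as a function of \<open>y\<close>: the likelihood of \<open>y\<close> given the
  noisy observation \<open>x\<close>.\<close>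

definition tilt :: "real \<Rightarrow> 'a::euclidean_space \<Rightarrow> 'a \<Rightarrow> real" where
  "tilt t x y = exp (- (1 / (2 * (1 - t\<^sup>2))) * (norm (t *\<^sub>R y - x))\<^sup>2)"

lemma tilt_pos: "0 < tilt t x y" by (simp add: tilt_def)

lemma abs_tilt [simp]: "\<bar>tilt t x y\<bar> = tilt t x y"
  using tilt_pos[of t x y] by simp

lemma one_minus_square_pos: "t \<in> {0..<1} \<Longrightarrow> 0 < 1 - t\<^sup>2" for t :: real
  by (simp add: abs_square_less_1)

lemma tilt_le_one: "t \<in> {0..<1} \<Longrightarrow> tilt t x y \<le> 1"
  using one_minus_square_pos[of t] by (simp add: tilt_def)

lemma tilt_measurable [measurable]: "tilt t x \<in> borel_measurable borel"
  unfolding tilt_def[abs_def] by measurable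

lemma tilt_lipschitz:
  assumes "t \<in> {0..T}" "T < 1"
  shows "\<bar>tilt t x y - tilt t x' y\<bar> \<le> (1 / (1 - T\<^sup>2) + 2) * norm (x - x')"
proof -
  have T: "0 < 1 - T\<^sup>2" using assms by (intro one_minus_square_pos) auto
  have "t\<^sup>2 \<le> T\<^sup>2" using assms by (intro power_mono) auto
  then have "1 / (1 - t\<^sup>2) \<le> 1 / (1 - T\<^sup>2)" using T by (intro divide_left_mono) auto
  moreover have "\<bar>tilt t x y - tilt t x' y\<bar> \<le> (1 / (1 - t\<^sup>2) + 2) * norm (x - x')"
  proof -
    define k where "k = 1 / (2 * (1 - t\<^sup>2))"
    have k: "0 \<le> k" "1 / (1 - t\<^sup>2) = 2 * k"
      using one_minus_square_pos[of t] assms unfolding k_def times_divide_eq_right mult_1_right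
      by (auto simp: divide_simps)
    have "(t *\<^sub>R y - x) - (t *\<^sub>R y - x') = x' - x" by simp
    with gaussian_lipschitz[OF k(1), of "t *\<^sub>R y - x" "t *\<^sub>R y - x'"] show ?thesis
      unfolding tilt_def k(2) k_def[symmetric] by (simp only: norm_minus_commute[of x'])
  qed
  ultimately show ?thesis
    by (smt (verit) mult_right_mono norm_ge_zero)
qed

lemma continuous_on_tilt: "continuous_on ({0..<1} \<times> UNIV) (\<lambda>z. tilt (fst z) (snd z) y)"
  unfolding tilt_def using one_minus_square_pos
  by (intro continuous_intros) (auto dest: one_minus_square_pos)

section \<open>Means of a probability measure under Gaussian tilts\<close>

text \<open>The first moment dominates the integrand of \<open>E\<close> uniformly in
  \<open>t\<close> and \<open>x\<close>, also at \<open>t = 0\<close>, where the weight does not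
  decay in \<open>y\<close>.\<close>

locale gaussian_tilt = prob_space M for M :: "'a::euclidean_space measure" +
  assumes sets_M [measurable_cong, simp]: "sets M = sets borel"
    and integrable_norm: "integrable M norm"
begin

lemma space_M [simp]: "space M = UNIV"
  using sets_eq_imp_space_eq[OF sets_M] by simp

text \<open>\<open>E t x / D t x\<close> is the mean of \<open>M\<close> tilted by \<open>tilt t x\<close>.\<close>

definition D where "D t x = (\<integral>y. tilt t x y \<partial>M)"
definition E where "E t x = (\<integral>y. tilt t x y *\<^sub>R y \<partial>M)"
definition field where "field t x = (1 / (1 - t\<^sup>2)) *\<^sub>R ((1 / D t x) *\<^sub>R E t x - t *\<^sub>R x)"
definition M1 where "M1 = (\<integral>y. norm y \<partial>M)"

lemma integrable_tilt: "t \<in> {0..<1} \<Longrightarrow> integrable M (tilt t x)"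
  by (rule integrable_const_bound[where B = 1]) (auto simp: tilt_le_one less_imp_le[OF tilt_pos])

lemma norm_tilt_scaleR_le: "t \<in> {0..<1} \<Longrightarrow> norm (tilt t x y *\<^sub>R y) \<le> norm y"
  using tilt_le_one[of t x y] tilt_pos[of t x y] by (simp add: mult_left_le_one_le less_imp_le)

lemma integrable_tilt_scaleR: "t \<in> {0..<1} \<Longrightarrow> integrable M (\<lambda>y. tilt t x y *\<^sub>R y)"
  by (rule Bochner_Integration.integrable_bound[OF integrable_norm])
     (use norm_tilt_scaleR_le in auto)

lemma D_pos: "t \<in> {0..<1} \<Longrightarrow> 0 < D t x"
  unfolding D_def using integral_less_AE_space[of "\<lambda>_. 0" "tilt t x"] emeasure_space_1
  by (simp add: integrable_tilt tilt_pos)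

lemma continuous_on_D: "continuous_on ({0..<1} \<times> UNIV) (\<lambda>z. D (fst z) (snd z))"
  unfolding D_def
  by (rule continuous_on_lebesgue_integral[where w = "\<lambda>_. 1"])
     (auto simp: tilt_le_one intro: continuous_on_tilt)

lemma continuous_on_E: "continuous_on ({0..<1} \<times> UNIV) (\<lambda>z. E (fst z) (snd z))"
  unfolding E_def
  by (rule continuous_on_lebesgue_integral[where w = norm])
     (auto simp: integrable_norm norm_tilt_scaleR_le simp del: norm_scaleR
       intro!: continuous_intros continuous_on_tilt)

lemma continuous_on_field: "continuous_on ({0..<1} \<times> UNIV) (\<lambda>(t, x). field t x)"
  unfolding field_def case_prod_beta
  by (intro continuous_intros continuous_on_D continuous_on_E)
     (use one_minus_square_pos D_pos in \<open>force simp: less_le\<close>)+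

lemma D_lipschitz:
  assumes "t \<in> {0..T}" "T < 1"
  shows "\<bar>D t x - D t x'\<bar> \<le> (1 / (1 - T\<^sup>2) + 2) * norm (x - x')"
proof -
  have t: "t \<in> {0..<1}" using assms by auto
  have "\<bar>D t x - D t x'\<bar> = norm (\<integral>y. tilt t x y - tilt t x' y \<partial>M)"
    by (simp add: D_def integrable_tilt[OF t])
  also have "\<dots> \<le> (\<integral>y. (1 / (1 - T\<^sup>2) + 2) * norm (x - x') \<partial>M)"
    using tilt_lipschitz[OF assms]
    by (intro Bochner_Integration.integral_norm_bound_integral Bochner_Integration.integrable_diff integrable_tilt[OF t]) auto
  finally show ?thesis by (simp add: prob_space[simplified])
qed

lemma E_lipschitz:
  assumes "t \<in> {0..T}" "T < 1"
  shows "norm (E t x - E t x') \<le> (1 / (1 - T\<^sup>2) + 2) * M1 * norm (x - x')"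
proof -
  have t: "t \<in> {0..<1}" using assms by auto
  have "norm (E t x - E t x') = norm (\<integral>y. tilt t x y *\<^sub>R y - tilt t x' y *\<^sub>R y \<partial>M)"
    by (simp add: E_def integrable_tilt_scaleR[OF t])
  also have "\<dots> \<le> (\<integral>y. (1 / (1 - T\<^sup>2) + 2) * norm (x - x') * norm y \<partial>M)"
    using tilt_lipschitz[OF assms] integrable_norm
    by (intro Bochner_Integration.integral_norm_bound_integral Bochner_Integration.integrable_diff integrable_tilt_scaleR[OF t])
       (auto intro!: mult_right_mono simp flip: scaleR_diff_left)
  finally show ?thesis by (simp add: M1_def mult_ac)
qed

lemma norm_E_le: "t \<in> {0..<1} \<Longrightarrow> norm (E t x) \<le> M1"
  unfolding E_def M1_def
  by (intro Bochner_Integration.integral_norm_bound_integral integrable_tilt_scaleR integrable_norm norm_tilt_scaleR_le)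

text \<open>Both \<open>D\<close> and \<open>E\<close> are Lipschitz in space with constants
  depending only on \<open>T\<close>. For their quotient it remains to bound \<open>D\<close> from
  below, which compactness of \<open>{0..T} \<times> cball 0 R\<close> and positivity of
  \<open>D\<close> provide.\<close>

lemma field_locally_lipschitz:
  assumes T: "T < 1"
  shows "\<exists>L. \<forall>t\<in>{0..T}. L-lipschitz_on (cball 0 R) (field t)"
proof (cases "0 \<le> T \<and> 0 \<le> R")
  case True
  have sT: "0 < 1 - T\<^sup>2" using True T by (intro one_minus_square_pos) auto
  define C where "C = 1 / (1 - T\<^sup>2) + 2"
  have C: "0 \<le> C" using sT by (simp add: C_def)
  have M1: "0 \<le> M1" by (simp add: M1_def)
  have compact: "compact ({0..T} \<times> cball (0::'a) R)" "{0..T} \<times> cball (0::'a) R \<noteq> {}"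
    using True by (auto intro: compact_Times)
  have "continuous_on ({0..T} \<times> cball 0 R) (\<lambda>z. D (fst z) (snd z))"
    using T by (intro continuous_on_subset[OF continuous_on_D]) auto
  from continuous_attains_inf[OF compact this] obtain z where z: "z \<in> {0..T} \<times> cball 0 R"
    "\<And>w. w \<in> {0..T} \<times> cball 0 R \<Longrightarrow> D (fst z) (snd z) \<le> D (fst w) (snd w)"
    by blast
  define \<delta> where "\<delta> = D (fst z) (snd z)"
  have \<delta>: "0 < \<delta>" unfolding \<delta>_def using z(1) T by (intro D_pos) auto
  define L where "L = (1 / (1 - T\<^sup>2)) * (C * M1 / \<delta> + C * M1 / \<delta>\<^sup>2 + 1)"
  have "L-lipschitz_on (cball 0 R) (field t)" if t: "t \<in> {0..T}" for t
  proof (rule lipschitz_onI)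
    show "0 \<le> L" unfolding L_def using sT C M1 \<delta> by auto
    fix x x' :: 'a assume x: "x \<in> cball 0 R" "x' \<in> cball 0 R"
    have t1: "t \<in> {0..<1}" using t T by auto
    have D: "\<delta> \<le> D t x" "\<delta> \<le> D t x'"
      using z(2)[of "(t, x)"] z(2)[of "(t, x')"] x t by (auto simp: \<delta>_def)
    \<comment> \<open>The difference of quotients is split so that each term contains the increment
      of only one of \<open>E\<close> and \<open>D\<close>.\<close>
    have "norm ((1 / D t x) *\<^sub>R E t x - (1 / D t x') *\<^sub>R E t x')
        = norm ((1 / D t x) *\<^sub>R (E t x - E t x') + ((D t x' - D t x) / (D t x * D t x')) *\<^sub>R E t x')"
    proof -
      have "(D t x' - D t x) / (D t x * D t x') = 1 / D t x - 1 / D t x'"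
        using D \<delta> by (simp add: field_simps)
      then show ?thesis by (simp add: scaleR_diff_left scaleR_diff_right)
    qed
    also have "\<dots> \<le> (1 / D t x) * norm (E t x - E t x') + \<bar>D t x' - D t x\<bar> / (D t x * D t x') * norm (E t x')"
      using D \<delta> by (intro norm_triangle_le) (simp add: abs_mult)
    also have "\<dots> \<le> (1 / \<delta>) * (C * M1 * norm (x - x')) + (C * norm (x - x')) / (\<delta> * \<delta>) * M1"
      using D \<delta> C M1 E_lipschitz[OF t T, of x x'] D_lipschitz[OF t T, of x x'] norm_E_le[OF t1]
      by (intro add_mono mult_mono frac_le) (auto simp: C_def abs_minus_commute)
    finally have 1: "norm ((1 / D t x) *\<^sub>R E t x - (1 / D t x') *\<^sub>R E t x')
        \<le> (C * M1 / \<delta> + C * M1 / \<delta>\<^sup>2) * norm (x - x')"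
      by (simp add: power2_eq_square algebra_simps)
    have 2: "norm (t *\<^sub>R x' - t *\<^sub>R x) \<le> 1 * norm (x - x')"
      using t T by (simp add: norm_minus_commute mult_left_le_one_le flip: scaleR_diff_right)
    have "t\<^sup>2 \<le> T\<^sup>2" using t by (intro power_mono) auto
    then have t3: "1 / (1 - t\<^sup>2) \<le> 1 / (1 - T\<^sup>2)" "0 < 1 - t\<^sup>2" using sT by (auto intro!: divide_left_mono)
    have "dist (field t x) (field t x') = (1 / (1 - t\<^sup>2)) *
        norm (((1 / D t x) *\<^sub>R E t x - (1 / D t x') *\<^sub>R E t x') + (t *\<^sub>R x' - t *\<^sub>R x))"
      using t3 unfolding dist_norm field_def by (simp flip: scaleR_diff_right) (simp add: algebra_simps)
    also have "\<dots> \<le> (1 / (1 - T\<^sup>2)) * ((C * M1 / \<delta> + C * M1 / \<delta>\<^sup>2) * norm (x - x') + 1 * norm (x - x'))"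
      using t3 sT by (intro mult_mono norm_triangle_le add_mono 1 2) auto
    finally show "dist (field t x) (field t x') \<le> L * dist x x'"
      by (simp add: L_def dist_norm algebra_simps)
  qed
  then show ?thesis by blast
next
  case False
  \<comment> \<open>For negative \<open>R\<close> or \<open>T\<close> the claim is vacuous.\<close>
  then have "cball (0::'a) R = {} \<or> {0..T} = {}" by auto
  then show ?thesis
  proof
    assume "cball (0::'a) R = {}"
    then show ?thesis by (metis lipschitz_on_empty order_refl)
  qed simp
qed

text \<open>Differentiation under the integral. The Taylor remainder is at most
  \<open>3 * k * (norm h)\<^sup>2\<close> for every \<open>y\<close>, and \<open>M\<close> has total
  mass 1, so the integrated remainder obeys the same bound.\<close>

lemma GDERIV_D:
  assumes t: "t \<in> {0..<1}"
  shows "GDERIV (D t) x :> (1 / (1 - t\<^sup>2)) *\<^sub>R (t *\<^sub>R E t x - D t x *\<^sub>R x)"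
proof -
  define k where "k = 1 / (2 * (1 - t\<^sup>2))"
  have k: "0 \<le> k" using one_minus_square_pos[OF t] by (simp add: k_def)
  have k2: "1 / (1 - t\<^sup>2) = 2 * k"
    using one_minus_square_pos[OF t] by (simp add: k_def divide_simps)
  define G where "G = (1 / (1 - t\<^sup>2)) *\<^sub>R (t *\<^sub>R E t x - D t x *\<^sub>R x)"
  have G_int: "((\<lambda>y. tilt t x y * (2 * k * ((t *\<^sub>R y - x) \<bullet> h)))) = (\<lambda>y. (2 * k) * (t * ((tilt t x y *\<^sub>R y) \<bullet> h) - tilt t x y * (x \<bullet> h)))" for h
    by (simp add: fun_eq_iff algebra_simps)
  have lin_integrable: "integrable M (\<lambda>y. tilt t x y * (2 * k * ((t *\<^sub>R y - x) \<bullet> h)))" for h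
    unfolding G_int using integrable_tilt[OF t] integrable_tilt_scaleR[OF t]
    by (intro Bochner_Integration.integrable_diff integrable_mult_right integrable_mult_left integrable_inner_left) auto
  have lin: "(\<integral>y. tilt t x y * (2 * k * ((t *\<^sub>R y - x) \<bullet> h)) \<partial>M) = h \<bullet> G" for h
  proof -
    have "(\<integral>y. tilt t x y * (2 * k * ((t *\<^sub>R y - x) \<bullet> h)) \<partial>M)
        = 2 * k * (\<integral>y. t * ((tilt t x y *\<^sub>R y) \<bullet> h) - tilt t x y * (x \<bullet> h) \<partial>M)"
      unfolding G_int by (rule integral_mult_right_zero)
    also have "(\<integral>y. t * ((tilt t x y *\<^sub>R y) \<bullet> h) - tilt t x y * (x \<bullet> h) \<partial>M)
        = t * (E t x \<bullet> h) - D t x * (x \<bullet> h)"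
      using integrable_tilt[OF t] integrable_tilt_scaleR[OF t]
      by (simp add: D_def E_def del: inner_scaleR_left)
    finally show ?thesis
      by (simp add: G_def k2 inner_diff_left inner_commute[of h])
  qed
  have "(D t has_derivative (\<lambda>h. h \<bullet> G)) (at x)"
  proof (rule has_derivativeI_sandwich[where e = 1 and H = "\<lambda>y. 3 * k * norm (y - x)"])
    show "((\<lambda>y. 3 * k * norm (y - x)) \<longlongrightarrow> 0) (at x)"
      by (auto intro!: tendsto_eq_intros)
    fix x' assume "x' \<noteq> x"
    define h where "h = x' - x"
    have "D t x' - D t x - h \<bullet> G
        = (\<integral>y. tilt t x' y - tilt t x y - tilt t x y * (2 * k * ((t *\<^sub>R y - x) \<bullet> h)) \<partial>M)"
      using integrable_tilt[OF t] lin_integrable by (simp add: D_def lin)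
    also have "norm \<dots> \<le> (\<integral>y. 3 * k * (norm h)\<^sup>2 \<partial>M)"
    proof (rule Bochner_Integration.integral_norm_bound_integral)
      fix y
      \<comment> \<open>Moving \<open>x\<close> by \<open>h\<close> moves
        \<open>t *\<^sub>R y - x\<close> by \<open>- h\<close>, which explains the sign in the
        remainder estimate.\<close>
      show "norm (tilt t x' y - tilt t x y - tilt t x y * (2 * k * ((t *\<^sub>R y - x) \<bullet> h))) \<le> 3 * k * (norm h)\<^sup>2"
        using gaussian_quadratic_remainder[OF k, of "t *\<^sub>R y - x" h]
        by (simp add: tilt_def k_def h_def)
    qed (use integrable_tilt[OF t] lin_integrable in auto)
    also have "\<dots> = 3 * k * (norm h)\<^sup>2" by (simp add: prob_space[simplified])
    finally show "norm (D t x' - D t x - (x' - x) \<bullet> G) / norm (x' - x) \<le> 3 * k * norm (x' - x)"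
      using \<open>x' \<noteq> x\<close> by (simp add: h_def field_simps power2_eq_square)
  qed (auto intro: bounded_linear_inner_left)
  then show ?thesis by (simp add: gderiv_def G_def)
qed

lemma field_zero: "field 0 x = (\<integral>y. y \<partial>M)"
  by (simp add: field_def D_def E_def tilt_def prob_space[simplified])

end

section \<open>The velocity field as a tilted mean\<close>

lemma gauss_density_pos: "0 < gauss_density x"
  by (simp add: gauss_density_def)

lemma gauss_density_measurable [measurable]: "gauss_density \<in> borel_measurable borel"
  unfolding gauss_density_def[abs_def] by measurable

text \<open>Completing the square: the part of the exponent that depends on \<open>x\<close> alone
  splits off, and the rest is the exponent of \<open>tilt\<close>.\<close>

lemma gauss_density_rescale:
  fixes x y :: "'a::euclidean_space"
  assumes t: "t \<in> {0..<1}"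
  shows "gauss_density ((1 / sqrt (1 - t\<^sup>2)) *\<^sub>R (y - t *\<^sub>R x)) / gauss_density y
    = exp ((norm x)\<^sup>2 / 2) * tilt t x y"
proof -
  have pos: "0 < 1 - t\<^sup>2" by (rule one_minus_square_pos[OF t])
  have "(norm ((1 / sqrt (1 - t\<^sup>2)) *\<^sub>R (y - t *\<^sub>R x)))\<^sup>2 = (norm (y - t *\<^sub>R x))\<^sup>2 / (1 - t\<^sup>2)"
    using pos by (simp add: power_divide)
  moreover have "- (norm (y - t *\<^sub>R x))\<^sup>2 + (1 - t\<^sup>2) * (norm y)\<^sup>2 = (1 - t\<^sup>2) * (norm x)\<^sup>2 - (norm (t *\<^sub>R y - x))\<^sup>2"
    unfolding power2_norm_eq_inner
    by (simp add: inner_diff_left inner_diff_right inner_commute algebra_simps power2_eq_square)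
  then have "- ((norm (y - t *\<^sub>R x))\<^sup>2 / (1 - t\<^sup>2)) / 2 + (norm y)\<^sup>2 / 2
      = (norm x)\<^sup>2 / 2 + - (1 / (2 * (1 - t\<^sup>2))) * (norm (t *\<^sub>R y - x))\<^sup>2"
    using pos by (simp add: divide_simps) (simp add: algebra_simps)
  ultimately show ?thesis
    by (simp add: gauss_density_def tilt_def exp_minus field_simps flip: exp_add exp_diff)
qed

text \<open>Substitute \<open>y = t *\<^sub>R x + sqrt (1 - t\<^sup>2) *\<^sub>R z\<close>; the
  prefactor is the inverse Jacobian, and the quotient of Gaussian densities is evaluated by
  \<open>gauss_density_rescale\<close>.\<close>

lemma Q_op_rel_density:
  fixes p :: "'a::euclidean_space \<Rightarrow> real"
  assumes p [measurable]: "p \<in> borel_measurable borel" and nonneg: "\<And>x. 0 \<le> p x"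
    and t: "t \<in> {0..<1}"
  shows "Q_op t (rel_density p) x = 1 / sqrt (1 - t\<^sup>2) ^ DIM('a) *
    (exp ((norm x)\<^sup>2 / 2) * (\<integral>y. tilt t x y \<partial>density lborel (\<lambda>y. ennreal (p y))))"
proof -
  let ?\<sigma> = "sqrt (1 - t\<^sup>2)"
  have \<sigma>: "0 < ?\<sigma>" using one_minus_square_pos[OF t] by simp
  have [measurable]: "rel_density p \<in> borel_measurable borel"
    unfolding rel_density_def[abs_def] by measurable
  define h where "h y = gauss_density ((1 / ?\<sigma>) *\<^sub>R (y - t *\<^sub>R x)) * rel_density p y" for y
  have [measurable]: "h \<in> borel_measurable borel" unfolding h_def[abs_def] by measurable
  have "Q_op t (rel_density p) x = (\<integral>z. h (t *\<^sub>R x + ?\<sigma> *\<^sub>R z) \<partial>lborel)"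
    unfolding Q_op_def gauss_measure_def
    using \<sigma> less_imp_le[OF gauss_density_pos] by (subst integral_density) (auto simp: h_def)
  moreover have "(\<integral>y. h y \<partial>lborel) = ?\<sigma> ^ DIM('a) * (\<integral>z. h (t *\<^sub>R x + ?\<sigma> *\<^sub>R z) \<partial>lborel)"
    using \<sigma> by (subst lborel_affine[of ?\<sigma> "t *\<^sub>R x"]) (auto simp: integral_density integral_distr)
  moreover have "(\<integral>y. h y \<partial>lborel) = exp ((norm x)\<^sup>2 / 2) * (\<integral>y. p y * tilt t x y \<partial>lborel)"
  proof -
    have "h y = exp ((norm x)\<^sup>2 / 2) * (p y * tilt t x y)" for y
    proof -
      have "h y = gauss_density ((1 / ?\<sigma>) *\<^sub>R (y - t *\<^sub>R x)) / gauss_density y * p y"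
        by (simp add: h_def rel_density_def)
      then show ?thesis unfolding gauss_density_rescale[OF t] by (simp add: mult_ac)
    qed
    then show ?thesis by simp
  qed
  moreover have "(\<integral>y. p y * tilt t x y \<partial>lborel) = (\<integral>y. tilt t x y \<partial>density lborel (\<lambda>y. ennreal (p y)))"
    using nonneg by (subst integral_density) auto
  ultimately show ?thesis using \<sigma> by (simp add: field_simps)
qed

lemma gradient_eqI: "GDERIV f x :> G \<Longrightarrow> gradient f x = G"
  unfolding gradient_def
proof (rule the_equality)
  fix G' assume "GDERIV f x :> G" "GDERIV f x :> G'"
  then have "(\<lambda>h. h \<bullet> G') = (\<lambda>h. h \<bullet> G)"
    unfolding gderiv_def by (rule has_derivative_unique[rotated])
  then have "(G' - G) \<bullet> (G' - G) = 0" by (simp add: inner_diff_right fun_eq_iff)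
  then show "G' = G" by simp
qed

text \<open>The logarithm of \<open>Q_op\<close> is a constant plus
  \<open>(norm y)\<^sup>2 / 2\<close> plus \<open>ln (D t y)\<close>. Its gradient carries a factor
  \<open>t\<close>, which cancels the \<open>1 / t\<close> in \<open>velocity\<close>; at
  \<open>t = 0\<close> both sides are the mean of the law.\<close>

lemma velocity_eq_field:
  fixes p :: "'a::euclidean_space \<Rightarrow> real"
  assumes p: "p \<in> borel_measurable borel" "\<And>x. 0 \<le> p x"
    and M: "gaussian_tilt (density lborel (\<lambda>x. ennreal (p x)))"
    and t: "t \<in> {0..<1}"
  shows "velocity p t x = gaussian_tilt.field (density lborel (\<lambda>x. ennreal (p x))) t x"
proof -
  interpret gaussian_tilt "density lborel (\<lambda>x. ennreal (p x))" by (rule M)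
  show ?thesis
  proof (cases "t = 0")
    case True
    then show ?thesis by (simp add: velocity_def field_zero)
  next
    case False
    have pos: "0 < 1 - t\<^sup>2" by (rule one_minus_square_pos[OF t])
    define c where "c = 1 / sqrt (1 - t\<^sup>2) ^ DIM('a)"
    have c: "0 < c" using pos by (simp add: c_def)
    have "ln (Q_op t (rel_density p) y) = ln c + (1 / 2 * (y \<bullet> y) + ln (D t y))" for y
      unfolding Q_op_rel_density[OF p t] c_def[symmetric] D_def[symmetric]
      using c D_pos[OF t, of y] by (simp add: ln_mult power2_norm_eq_inner)
    then have ln_Q: "(\<lambda>y. ln (Q_op t (rel_density p) y)) = (\<lambda>y. ln c + (1 / 2 * (y \<bullet> y) + ln (D t y)))"
      by blast
    have "GDERIV (\<lambda>y. 1 / 2 * (y \<bullet> y)) x :> x"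
      unfolding gderiv_def by (auto intro!: derivative_eq_intros simp: fun_eq_iff inner_commute)
    moreover have "(ln has_real_derivative 1 / D t x) (at (D t x))"
      using D_pos[OF t, of x] by (rule DERIV_ln_divide)
    note GDERIV_DERIV_compose[OF GDERIV_D[OF t] this]
    ultimately have "GDERIV (\<lambda>y. ln c + (1 / 2 * (y \<bullet> y) + ln (D t y))) x :>
        0 + (x + (1 / D t x) *\<^sub>R (1 / (1 - t\<^sup>2)) *\<^sub>R (t *\<^sub>R E t x - D t x *\<^sub>R x))"
      by (intro GDERIV_add GDERIV_const)
    from gradient_eqI[OF this]
    have "score p t x = x + (1 / D t x) *\<^sub>R (1 / (1 - t\<^sup>2)) *\<^sub>R (t *\<^sub>R E t x - D t x *\<^sub>R x)"
      unfolding score_def ln_Q by simp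
    also have "\<dots> = t *\<^sub>R field t x"
    proof -
      have 1: "(1 / D t x) *\<^sub>R (1 / (1 - t\<^sup>2)) *\<^sub>R (t *\<^sub>R E t x - D t x *\<^sub>R x)
          = (t / ((1 - t\<^sup>2) * D t x)) *\<^sub>R E t x - (1 / (1 - t\<^sup>2)) *\<^sub>R x"
        using D_pos[OF t, of x] by (simp add: scaleR_diff_right mult_ac)
      have 2: "t *\<^sub>R field t x = (t / ((1 - t\<^sup>2) * D t x)) *\<^sub>R E t x - (t\<^sup>2 / (1 - t\<^sup>2)) *\<^sub>R x"
        by (simp add: field_def scaleR_diff_right power2_eq_square)
      have "1 / (1 - t\<^sup>2) = 1 + t\<^sup>2 / (1 - t\<^sup>2)" using pos by (simp add: field_simps)
      then have 3: "(1 / (1 - t\<^sup>2)) *\<^sub>R x = x + (t\<^sup>2 / (1 - t\<^sup>2)) *\<^sub>R x"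
        by (simp add: scaleR_left_distrib)
      show ?thesis unfolding 1 2 3 by simp
    qed
    finally show ?thesis using False by (simp add: velocity_def)
  qed
qed

section \<open>From the Sobolev hypothesis to an integrable pointwise bound\<close>

text \<open>For continuous \<open>u\<close> the set where the norm exceeds its essential supremum is
  open and null, hence empty, so the bound holds at every point.\<close>

lemma norm_le_W1inf_norm:
  fixes u :: "'a::euclidean_space \<Rightarrow> 'b::euclidean_space"
  assumes "continuous_on UNIV u"
  shows "ennreal (norm (u x)) \<le> W1inf_norm u"
proof -
  define c where "c = Linf_norm u"
  have "AE x in lborel. ennreal (norm (u x)) \<le> c"
    unfolding c_def Linf_norm_def by (rule esssup_AE)
  have "ennreal (norm (u x)) \<le> c"
  proof (cases "c = \<infinity>")
    case False
    define S where "S = {x. enn2real c < norm (u x)}"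
    have c: "c = ennreal (enn2real c)" using False by (simp add: less_top)
    have S_iff: "x \<in> S \<longleftrightarrow> \<not> ennreal (norm (u x)) \<le> c" for x
      by (subst c) (simp add: S_def not_le)
    have "open S"
      unfolding S_def using assms by (intro open_Collect_less continuous_intros)
    moreover have "S \<in> null_sets lborel"
    proof -
      have "AE x in lborel. x \<notin> S"
        using \<open>AE x in lborel. ennreal (norm (u x)) \<le> c\<close> by eventually_elim (simp add: S_iff)
      then show ?thesis using \<open>open S\<close> by (simp add: AE_iff_null_sets)
    qed
    then have "negligible S"
      by (simp add: negligible_iff_null_sets null_sets_completionI)
    ultimately have "S = {}" using open_not_negligible by blast
    then show ?thesis using S_iff by auto
  qed simp
  \<comment> \<open>\<open>Linf_norm u\<close> is a summand of every competitor, and an infimum over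
    the empty set is infinite.\<close>
  also have "c \<le> W1inf_norm u"
    unfolding W1inf_norm_def c_def by (rule INF_greatest) simp
  finally show ?thesis .
qed

lemma velocity_integrably_bounded_field:
  fixes p :: "'a::euclidean_space \<Rightarrow> real"
  assumes p: "p \<in> borel_measurable borel" "\<And>x. 0 \<le> p x"
    and M: "gaussian_tilt (density lborel (\<lambda>x. ennreal (p x)))"
    and V: "L1_W1inf (velocity p)"
  shows "\<exists>m N. integrably_bounded_field (velocity p) m N"
proof -
  interpret gaussian_tilt "density lborel (\<lambda>x. ennreal (p x))" by (rule M)
  have eq: "velocity p t x = field t x" if "t \<in> {0..<1}" for t x
    by (rule velocity_eq_field[OF p M that])
  define w where "w t = W1inf_norm (velocity p t)" for t
  \<comment> \<open>Where the norm is infinite, \<open>enn2real\<close> returns 0 and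
    \<open>m\<close> is no bound; these times form a null set and are put into
    \<open>N\<close>.\<close>
  define m where "m t = enn2real (w t)" for t
  have w [measurable]: "w \<in> borel_measurable (lebesgue_on {0..1})"
    and w_fin: "(\<integral>\<^sup>+t. w t \<partial>lebesgue_on {0..1}) < \<infinity>"
    using V unfolding L1_W1inf_def w_def[abs_def] by auto
  have "AE t in lebesgue_on {0..1}. w t \<noteq> \<infinity>"
    using w w_fin by (intro nn_integral_PInf_AE) auto
  then have "AE t in lebesgue. t \<in> {0..1} \<longrightarrow> w t \<noteq> \<infinity>"
    by (simp add: AE_restrict_space_iff)
  then obtain N where N: "N \<in> null_sets lebesgue" "{t \<in> space lebesgue. \<not> (t \<in> {0..1} \<longrightarrow> w t \<noteq> \<infinity>)} \<subseteq> N"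
    unfolding eventually_ae_filter by blast
  have V_cont: "continuous_on ({0..<1} \<times> UNIV) (\<lambda>(t, x). velocity p t x)"
    using continuous_on_field by (rule continuous_on_eq) (auto simp: eq)
  have "integrably_bounded_field (velocity p) m N"
  proof
    show "continuous_on ({0..<1} \<times> UNIV) (\<lambda>(t, x). velocity p t x)" by (rule V_cont)
    show "negligible N" using N by (simp add: negligible_iff_null_sets)
    show m_nonneg: "0 \<le> m t" for t by (simp add: m_def)
    have "(\<integral>\<^sup>+t. ennreal (m t) \<partial>lebesgue_on {0..1}) \<le> (\<integral>\<^sup>+t. w t \<partial>lebesgue_on {0..1})"
      by (intro nn_integral_mono) (simp add: m_def ennreal_enn2real_if)
    then have "integrable (lebesgue_on {0..1}) m"
      using w_fin w unfolding m_def[abs_def] by (intro integrableI_nonneg) auto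
    then show "m integrable_on {0..1}" by (rule integrable_on_lebesgue_on) simp
    fix t x assume t: "t \<in> {0..<1} - N"
    have "continuous_on UNIV (\<lambda>x::'a. (t, x))" by (intro continuous_intros)
    from continuous_on_compose2[OF V_cont this] have "continuous_on UNIV (velocity p t)"
      using t by (simp add: image_subset_iff)
    then have "ennreal (norm (velocity p t x)) \<le> w t" unfolding w_def by (rule norm_le_W1inf_norm)
    moreover have "w t = ennreal (m t)" using t N by (auto simp: m_def less_top)
    ultimately show "norm (velocity p t x) \<le> m t" by (simp only: ennreal_le_iff m_nonneg)
  next
    fix T R :: real assume T: "T < 1"
    have "velocity p t = field t" if "t \<in> {0..T}" for t
      by (intro ext eq) (use that T in auto)
    then show "\<exists>L. \<forall>t\<in>{0..T}. L-lipschitz_on (cball 0 R) (velocity p t)"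
      using field_locally_lipschitz[OF T, of R] by simp
  qed
  then show ?thesis by blast
qed

section \<open>Comparison of the two flows\<close>

lemma ivp_flow_eqI:
  assumes "ivp_unique_solution F T x" "ivp_solution F T x X" "t \<in> {0..T}"
  shows "ivp_flow F T x t = X t"
  unfolding ivp_flow_def
  using assms by (intro the_equality) (auto simp: ivp_unique_solution_def)

lemma (in integrably_bounded_field) ivp_solution_iff_solution:
  "ivp_solution V 1 x X \<longleftrightarrow> X 0 = x \<and> solution 0 X"
  by (simp add: ivp_solution_def solution_def)

text \<open>The time change \<open>\<tau> = exp (- (s - t))\<close> turns a Langevin trajectory on \<open>[0, s]\<close> into a
  trajectory of the velocity field on \<open>[exp (- s), 1]\<close>.\<close>

locale time_changed_field = integrably_bounded_field V m N
  for V :: "real \<Rightarrow> 'a::euclidean_space \<Rightarrow> 'a" and m N +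
  fixes F :: "real \<Rightarrow> 'a \<Rightarrow> 'a" and s :: real
  assumes s: "0 < s"
    and F: "0 \<le> t \<Longrightarrow> t < s \<Longrightarrow> F t x = exp (- (s - t)) *\<^sub>R V (exp (- (s - t))) x"
begin

text \<open>Chain rule: the new time \<open>exp (- (s - t))\<close> is its own derivative, which is
  the factor relating \<open>F\<close> to \<open>V\<close>.\<close>

lemma solution_imp_ivp_solution:
  assumes X: "solution (exp (- s)) X"
  shows "ivp_solution F s (X (exp (- s))) (\<lambda>t. X (exp (- (s - t))))"
  unfolding ivp_solution_def
proof (intro conjI ballI)
  show "continuous_on {0..s} (\<lambda>t. X (exp (- (s - t))))"
  proof (rule continuous_on_compose2[of "{exp (- s)..1}" X])
    show "continuous_on {exp (- s)..1} X" using X by (simp add: solution_def)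
  qed (auto intro!: continuous_intros)
  fix t assume t: "t \<in> {0..<s}"
  have "((\<lambda>t. exp (- (s - t))) has_vector_derivative exp (- (s - t))) (at t within {0..s})"
    unfolding has_real_derivative_iff_has_vector_derivative[symmetric]
    by (auto intro!: derivative_eq_intros)
  moreover have "(X has_vector_derivative V (exp (- (s - t))) (X (exp (- (s - t)))))
      (at (exp (- (s - t))) within (\<lambda>t. exp (- (s - t))) ` {0..s})"
  proof (rule has_vector_derivative_within_subset)
    show "(X has_vector_derivative V (exp (- (s - t))) (X (exp (- (s - t)))))
        (at (exp (- (s - t))) within {exp (- s)..1})"
      using X t unfolding solution_def by simp
  qed auto
  ultimately show "((\<lambda>t. X (exp (- (s - t)))) has_vector_derivative F t (X (exp (- (s - t))))) (at t within {0..s})"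
    using vector_diff_chain_within[of "\<lambda>t. exp (- (s - t))" _ t "{0..s}" X] F[of t] t
    by (simp add: o_def)
qed simp

text \<open>The inverse time change is \<open>t = s + ln \<tau>\<close>; its derivative
  \<open>1 / \<tau>\<close> cancels the factor in \<open>F\<close>.\<close>

lemma ivp_solution_imp_solution:
  assumes Y: "ivp_solution F s x Y"
  shows "solution (exp (- s)) (\<lambda>\<tau>. Y (s + ln \<tau>))"
  unfolding solution_def
proof (intro conjI ballI)
  have pos: "0 < \<tau>" if "exp (- s) \<le> \<tau>" for \<tau>
    using that exp_gt_zero[of "- s"] by linarith
  have ln: "- s \<le> ln \<tau>" if "exp (- s) \<le> \<tau>" for \<tau>
    using that pos by (simp add: ln_ge_iff)
  have maps: "(\<lambda>\<tau>. s + ln \<tau>) ` {exp (- s)..1} \<subseteq> {0..s}"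
    using ln pos by force
  show "continuous_on {exp (- s)..1} (\<lambda>\<tau>. Y (s + ln \<tau>))"
  proof (rule continuous_on_compose2[OF _ _ maps])
    show "continuous_on {0..s} Y" using Y by (simp add: ivp_solution_def)
    show "continuous_on {exp (- s)..1} (\<lambda>\<tau>. s + ln \<tau>)"
      by (intro continuous_intros) (use pos in force)
  qed
  fix \<tau> assume \<tau>: "\<tau> \<in> {exp (- s)..<1}"
  define t where "t = s + ln \<tau>"
  have \<tau>_pos: "0 < \<tau>" using pos \<tau> by simp
  have t: "0 \<le> t" "t < s" "exp (- (s - t)) = \<tau>" using ln[of \<tau>] \<tau> \<tau>_pos by (auto simp: t_def)
  have "((\<lambda>\<tau>. s + ln \<tau>) has_vector_derivative 1 / \<tau>) (at \<tau> within {exp (- s)..1})"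
    unfolding has_real_derivative_iff_has_vector_derivative[symmetric]
    using \<tau>_pos by (auto intro!: derivative_eq_intros)
  moreover have "(Y has_vector_derivative F t (Y t)) (at t within {0..s})"
    using Y t unfolding ivp_solution_def by simp
  then have "(Y has_vector_derivative F t (Y t)) (at t within (\<lambda>\<tau>. s + ln \<tau>) ` {exp (- s)..1})"
    by (rule has_vector_derivative_within_subset) (rule maps)
  ultimately have "((\<lambda>\<tau>. Y (s + ln \<tau>)) has_vector_derivative (1 / \<tau>) *\<^sub>R F t (Y t)) (at \<tau> within {exp (- s)..1})"
    unfolding t_def by (rule vector_diff_chain_within[unfolded o_def])
  then show "((\<lambda>\<tau>. Y (s + ln \<tau>)) has_vector_derivative V \<tau> (Y (s + ln \<tau>))) (at \<tau> within {exp (- s)..1})"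
    using F[OF t(1,2)] t(3) \<tau>_pos by (simp add: t_def)
qed

text \<open>Existence is carried from \<open>V\<close> to \<open>F\<close> by one time change,
  uniqueness is pulled back by the other.\<close>

lemma ivp_unique_solution: "ivp_unique_solution F s x"
  unfolding ivp_unique_solution_def
proof (intro conjI allI impI ballI)
  have "0 \<le> exp (- s)" "exp (- s) < 1" using s by auto
  then obtain X where "solution (exp (- s)) X" "X (exp (- s)) = x" by (rule solution_exists)
  then show "\<exists>X. ivp_solution F s x X" using solution_imp_ivp_solution by blast
  fix Y Z t assume Y: "ivp_solution F s x Y" and Z: "ivp_solution F s x Z" and t: "t \<in> {0..s}"
  have "Y (s + ln (exp (- (s - t)))) = Z (s + ln (exp (- (s - t))))"
    by (rule solution_unique[OF ivp_solution_imp_solution[OF Y] ivp_solution_imp_solution[OF Z]])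
       (use s t Y Z in \<open>auto simp: ivp_solution_def\<close>)
  then show "Y t = Z t" by simp
qed

lemma ivp_flow_end:
  assumes "solution (exp (- s)) X"
  shows "ivp_flow F s (X (exp (- s))) s = X 1"
  using ivp_flow_eqI[OF ivp_unique_solution solution_imp_ivp_solution[OF assms], of s] s by simp

end

theorem proposition2:
  fixes p :: "'a::euclidean_space \<Rightarrow> real"
  assumes "p \<in> borel_measurable borel"
    and "\<And>x. 0 \<le> p x"
    and "prob_space (density lborel (\<lambda>x. ennreal (p x)))"
    and "absolutely_continuous gauss_measure (density lborel (\<lambda>x. ennreal (p x)))"
    and "integrable (density lborel (\<lambda>x. ennreal (p x))) (\<lambda>x. (norm x)\<^sup>2)"
    and "L1_W1inf (velocity p)"
  shows "AE x in lborel. follmer_map_defined p x \<and> langevin_map_defined p x \<and>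
           follmer_map p x = langevin_map p x"
\<comment> \<open>The claim is shown at every point \<open>x\<close>.\<close>
proof (rule AE_I2)
  fix x :: 'a
  interpret P: prob_space "density lborel (\<lambda>x. ennreal (p x))" by (rule assms(3))
  have "gaussian_tilt (density lborel (\<lambda>x. ennreal (p x)))"
  proof
    show "integrable (density lborel (\<lambda>x. ennreal (p x))) norm"
      \<comment> \<open>On a probability space a finite second moment gives a finite first
        moment.\<close>
      by (rule P.square_integrable_imp_integrable[OF _ assms(5)]) simp
  qed simp
  from velocity_integrably_bounded_field[OF assms(1,2) this assms(6)]
  obtain m N where "integrably_bounded_field (velocity p) m N" by blast
  then interpret integrably_bounded_field "velocity p" m N .
  obtain X where X: "solution 0 X" "X 0 = x" by (rule solution_exists[of 0]) auto
  have follmer: "ivp_unique_solution (velocity p) 1 x"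
    unfolding ivp_unique_solution_def ivp_solution_iff_solution
    using X solution_unique[of 0] by auto
  have follmer_map: "follmer_map p x = X 1"
    unfolding follmer_map_def follmer_flow_def
    using ivp_flow_eqI[OF follmer, of X] X by (simp add: ivp_solution_iff_solution)
  have "\<forall>\<epsilon>\<in>{0<..<1}. \<exists>Z. solution \<epsilon> Z \<and> Z \<epsilon> = x"
  proof
    fix \<epsilon> :: real assume "\<epsilon> \<in> {0<..<1}"
    then have "0 \<le> \<epsilon>" "\<epsilon> < 1" by auto
    then obtain Z where "solution \<epsilon> Z" "Z \<epsilon> = x" by (rule solution_exists)
    then show "\<exists>Z. solution \<epsilon> Z \<and> Z \<epsilon> = x" by blast
  qed
  \<comment> \<open>One trajectory for each starting time in \<open>{0<..<1}\<close>, all issuing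
    from the same point \<open>x\<close>.\<close>
  from bchoice[OF this] obtain Z where "\<forall>\<epsilon>\<in>{0<..<1}. solution \<epsilon> (Z \<epsilon>) \<and> Z \<epsilon> \<epsilon> = x" ..
  then have Z: "\<And>\<epsilon>. 0 < \<epsilon> \<Longrightarrow> \<epsilon> < 1 \<Longrightarrow> solution \<epsilon> (Z \<epsilon>)"
    "\<And>\<epsilon>. 0 < \<epsilon> \<Longrightarrow> \<epsilon> < 1 \<Longrightarrow> Z \<epsilon> \<epsilon> = x"
    by auto
  \<comment> \<open>At the positive time \<open>exp (- (s - t))\<close> the score is that time
    multiplied by the velocity, directly from the definition of \<open>velocity\<close>.\<close>
  have time_change: "time_changed_field (velocity p) m N (langevin_field p s) s" if "0 < s" for s
    by unfold_locales (use that in \<open>auto simp: langevin_field_def velocity_def\<close>)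
  have unique: "ivp_unique_solution (langevin_field p s) s x" if "0 \<le> s" for s
  proof (cases "s = 0")
    case True
    \<comment> \<open>For \<open>s = 0\<close> the interval is a single point and only the initial
      condition remains.\<close>
    then show ?thesis by (auto simp: ivp_unique_solution_def ivp_solution_def)
  next
    case False
    with that time_changed_field.ivp_unique_solution[OF time_change] show ?thesis by simp
  qed
  have end_value: "langevin_flow p s s x = Z (exp (- s)) 1" if "0 < s" for s
    using time_changed_field.ivp_flow_end[OF time_change[OF that] Z(1)] Z(2)[of "exp (- s)"] that
    by (simp add: langevin_flow_def)
  \<comment> \<open>As \<open>s\<close> grows, the starting time \<open>exp (- s)\<close> tends to 0
    from the right, the limit treated in \<open>solution_start_tendsto\<close>.\<close>
  have "filterlim (\<lambda>s::real. exp (- s)) (at_right 0) at_top"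
    by (auto simp: filterlim_at intro!: filterlim_compose[OF exp_at_bot] filterlim_uminus_at_bot_at_top)
  with solution_start_tendsto[OF X Z] have "((\<lambda>s. Z (exp (- s)) 1) \<longlongrightarrow> X 1) at_top"
    by (rule filterlim_compose)
  then have lim: "((\<lambda>s. langevin_flow p s s x) \<longlongrightarrow> X 1) at_top"
    by (rule Lim_transform_eventually)
       (use end_value in \<open>auto intro: eventually_mono[OF eventually_gt_at_top[of 0]]\<close>)
  then have "langevin_map p x = X 1" unfolding langevin_map_def by (intro tendsto_Lim) auto
  with follmer_map follmer unique lim show "follmer_map_defined p x \<and> langevin_map_defined p x \<and>
      follmer_map p x = langevin_map p x"
    by (auto simp: follmer_map_defined_def langevin_map_defined_def)
qed

end
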